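(* Let $\phi:\mathcal{M}_s(\mathbb{H})\to\mathcal{M}_s(\mathbb{H})$ be any (unital) $\mathbb{R}$-algebra endomorphism of $\mathcal{M}_s(\mathbb{H})$. Then there exists exactly one entire function $h:\mathbb{H}\to\mathbb{H}$ such that $\phi(f)=f\circ h$ for all $f\in\mathcal{M}_s(\mathbb{H})$.
   Context: $\mathbb{H}$ denotes the real quaternions, $\mathbb{S}=\{I\in\mathbb{H}: I^2=-1\}$, and for $I\in\mathbb{S}$, $\mathbb{C}_I=\mathbb{R}+I\mathbb{R}$. A domain is a nonempty connected open subset of $\mathbb{H}\cong\mathbb{R}^4$ (resp. of $\mathbb{C}_I$). A symmetric slice domain is a domain $D\subset\mathbb{H}$ such that $D\cap\mathbb{R}\neq\emptyset$, $D\cap\mathbb{C}_I$ is a domain in $\mathbb{C}_I$ for every $I\in\mathbb{S}$, and whenever $x+Iy\in D$ ($x,y\in\mathbb{R}$, $I\in\mathbb{S}$) then $x+Jy\in D$ for all $J\in\mathbb{S}$. A function $f:D\to\mathbb{H}$ is regular if for every $I\in\mathbb{S}$ its restriction $f_I$ to $D\cap\mathbb{C}_I$ has continuous partial derivatives and satisfies $\frac12\left(\frac{\partial}{\partial x}+I\frac{\partial}{\partial y}\right)f_I(x+Iy)=0$ for all $x+Iy\in D\cap\mathbb{C}_I$. A regular $f$ is slice preserving if $f(D\cap\mathbb{C}_I)\subset\mathbb{C}_I$ for every $I\in\mathbb{S}$. An entire function is a regular function on $\mathbb{H}$. Singularities: let $f$ be regular on a symmetric slice domain $A$. A point $p\in\mathbb{C}_I$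 is a singularity of $f$ if $A$ contains $\{z\in\mathbb{C}_I:0<|z-p|<R\}$ for some $R>0$; on this set $f(z)=\sum_{n\in\mathbb{Z}}(z-p)^n a_n$ with unique $a_n\in\mathbb{H}$ (Laurent expansion). The singularity is removable if $f$ extends to a regular function on a neighborhood of $p$; a nonremovable singularity is a pole if there is an integer $\ell\ge0$ with $a_{-n}=0$ for all $n>\ell$. A slice preserving semiregular function on $D$ is a function $f$ which is slice preserving regular on some symmetric slice domain $A\subset D$ and such that every point of $D\setminus A$ is a pole or a removable singularity of $f$. $\mathcal{M}_s(D)$ is the set of these functions (two being identified if they agree where both are regular, removable singularities being filled in), with pointwise addition and multiplication; it is a field and an $\mathbb{R}$-algebra. The equality $\phi(f)=f\circ h$ is understood as equality of (slice preserving) semiregular functions: writing $f=\alpha/\beta$ with $\alpha,\beta$ slice preserving entire functions, $\beta\not\equiv 0$ (always possible on $\mathbb{H}$), it means $\beta\circ h\not\equiv0$ and $\phi(f)=(\alpha\circ h)/(\beta\circ h)$. *)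

theory Defs
  imports "HOL-Analysis.Analysis" "HOL-Algebra.Module"
begin

section \<open>The real quaternions as a normed division algebra\<close>

datatype quat = Quat (qRe: real) (qIm1: real) (qIm2: real) (qIm3: real)

lemma quat_eq_iff:
  "p = q \<longleftrightarrow> qRe p = qRe q \<and> qIm1 p = qIm1 q \<and> qIm2 p = qIm2 q \<and> qIm3 p = qIm3 q"
  by (cases p; cases q) simp

instantiation quat :: real_vector
begin

definition zero_quat :: quat where "0 = Quat 0 0 0 0"

definition plus_quat :: "quat \<Rightarrow> quat \<Rightarrow> quat" where
  "p + q = Quat (qRe p + qRe q) (qIm1 p + qIm1 q) (qIm2 p + qIm2 q) (qIm3 p + qIm3 q)"

definition uminus_quat :: "quat \<Rightarrow> quat" where
  "- p = Quat (- qRe p) (- qIm1 p) (- qIm2 p) (- qIm3 p)"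

definition minus_quat :: "quat \<Rightarrow> quat \<Rightarrow> quat" where
  "p - q = Quat (qRe p - qRe q) (qIm1 p - qIm1 q) (qIm2 p - qIm2 q) (qIm3 p - qIm3 q)"

definition scaleR_quat :: "real \<Rightarrow> quat \<Rightarrow> quat" where
  "c *\<^sub>R p = Quat (c * qRe p) (c * qIm1 p) (c * qIm2 p) (c * qIm3 p)"

instance
proof
  fix p q r :: quat and c d :: real
  show "p + q + r = p + (q + r)" "p + q = q + p" "0 + p = p" "- p + p = 0" "p - q = p + - q"
    by (simp_all add: zero_quat_def plus_quat_def uminus_quat_def minus_quat_def)
  show "c *\<^sub>R (p + q) = c *\<^sub>R p + c *\<^sub>R q" "(c + d) *\<^sub>R p = c *\<^sub>R p + d *\<^sub>R p"
    "c *\<^sub>R d *\<^sub>R p = (c * d) *\<^sub>R p" "1 *\<^sub>R p = p"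
    by (simp_all add: plus_quat_def scaleR_quat_def algebra_simps)
qed

end

lemma quat_add_sel [simp]:
  "qRe (p + q) = qRe p + qRe q" "qIm1 (p + q) = qIm1 p + qIm1 q"
  "qIm2 (p + q) = qIm2 p + qIm2 q" "qIm3 (p + q) = qIm3 p + qIm3 q"
  "qRe (p - q) = qRe p - qRe q" "qIm1 (p - q) = qIm1 p - qIm1 q"
  "qIm2 (p - q) = qIm2 p - qIm2 q" "qIm3 (p - q) = qIm3 p - qIm3 q"
  "qRe (- p) = - qRe p" "qIm1 (- p) = - qIm1 p" "qIm2 (- p) = - qIm2 p" "qIm3 (- p) = - qIm3 p"
  "qRe 0 = 0" "qIm1 0 = 0" "qIm2 0 = 0" "qIm3 0 = 0"
  "qRe (c *\<^sub>R p) = c * qRe p" "qIm1 (c *\<^sub>R p) = c * qIm1 p"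
  "qIm2 (c *\<^sub>R p) = c * qIm2 p" "qIm3 (c *\<^sub>R p) = c * qIm3 p"
  by (simp_all add: zero_quat_def plus_quat_def uminus_quat_def minus_quat_def scaleR_quat_def)

instantiation quat :: real_algebra_1
begin

definition one_quat :: quat where "1 = Quat 1 0 0 0"

definition times_quat :: "quat \<Rightarrow> quat \<Rightarrow> quat" where
  "p * q = Quat
     (qRe p * qRe q - qIm1 p * qIm1 q - qIm2 p * qIm2 q - qIm3 p * qIm3 q)
     (qRe p * qIm1 q + qIm1 p * qRe q + qIm2 p * qIm3 q - qIm3 p * qIm2 q)
     (qRe p * qIm2 q - qIm1 p * qIm3 q + qIm2 p * qRe q + qIm3 p * qIm1 q)
     (qRe p * qIm3 q + qIm1 p * qIm2 q - qIm2 p * qIm1 q + qIm3 p * qRe q)"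

instance
proof
  fix p q r :: quat and c :: real
  show "p * q * r = p * (q * r)"
    by (simp add: times_quat_def algebra_simps)
  show "(p + q) * r = p * r + q * r" "p * (q + r) = p * q + p * r"
    by (simp_all add: times_quat_def plus_quat_def algebra_simps)
  show "c *\<^sub>R p * q = c *\<^sub>R (p * q)" "p * c *\<^sub>R q = c *\<^sub>R (p * q)"
    by (simp_all add: times_quat_def scaleR_quat_def algebra_simps)
  show "1 * p = p" "p * 1 = p" "(0 :: quat) \<noteq> 1"
    by (simp_all add: zero_quat_def one_quat_def times_quat_def)
qed

end

lemma quat_mult_sel [simp]:
  "qRe (p * q) = qRe p * qRe q - qIm1 p * qIm1 q - qIm2 p * qIm2 q - qIm3 p * qIm3 q"
  "qIm1 (p * q) = qRe p * qIm1 q + qIm1 p * qRe q + qIm2 p * qIm3 q - qIm3 p * qIm2 q"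
  "qIm2 (p * q) = qRe p * qIm2 q - qIm1 p * qIm3 q + qIm2 p * qRe q + qIm3 p * qIm1 q"
  "qIm3 (p * q) = qRe p * qIm3 q + qIm1 p * qIm2 q - qIm2 p * qIm1 q + qIm3 p * qRe q"
  "qRe 1 = 1" "qIm1 1 = 0" "qIm2 1 = 0" "qIm3 1 = 0"
  by (simp_all add: one_quat_def times_quat_def)

instantiation quat :: real_normed_vector
begin

definition norm_quat :: "quat \<Rightarrow> real" where
  "norm p = sqrt ((qRe p)\<^sup>2 + (qIm1 p)\<^sup>2 + (qIm2 p)\<^sup>2 + (qIm3 p)\<^sup>2)"

definition sgn_quat :: "quat \<Rightarrow> quat" where "sgn (p :: quat) = p /\<^sub>R norm p"

definition dist_quat :: "quat \<Rightarrow> quat \<Rightarrow> real" where "dist (p :: quat) q = norm (p - q)"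

definition uniformity_quat :: "(quat \<times> quat) filter" where
  "uniformity = (INF e\<in>{0 <..}. principal {(p :: quat, q). dist p q < e})"

definition open_quat :: "quat set \<Rightarrow> bool" where
  "open (U :: quat set) \<longleftrightarrow> (\<forall>p\<in>U. eventually (\<lambda>(p', q). p' = p \<longrightarrow> q \<in> U) uniformity)"

instance
proof
  fix p q :: quat and c :: real
  have norm_tuple: "norm r = norm ((qRe r, qIm1 r), (qIm2 r, qIm3 r))" for r :: quat
    by (simp add: norm_quat_def norm_prod_def add.assoc)
  show "dist p q = norm (p - q)" by (rule dist_quat_def)
  show "sgn (p :: quat) = p /\<^sub>R norm p" by (rule sgn_quat_def)
  show "norm p = 0 \<longleftrightarrow> p = 0" 
    by (simp add: norm_tuple prod_eq_iff quat_eq_iff [of p 0])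
  show "norm (p + q) \<le> norm p + norm q"
    using norm_triangle_ineq [of "((qRe p, qIm1 p), (qIm2 p, qIm3 p))"
        "((qRe q, qIm1 q), (qIm2 q, qIm3 q))"]
    by (simp add: norm_tuple)
  show "norm (c *\<^sub>R p) = \<bar>c\<bar> * norm p"
    using norm_scaleR [of c "((qRe p, qIm1 p), (qIm2 p, qIm3 p))"] by (simp add: norm_tuple)
qed (auto simp: uniformity_quat_def open_quat_def)

end

instantiation quat :: real_inner
begin

definition inner_quat :: "quat \<Rightarrow> quat \<Rightarrow> real" where
  "inner p q = qRe p * qRe q + qIm1 p * qIm1 q + qIm2 p * qIm2 q + qIm3 p * qIm3 q"

instance
proof
  fix p q r :: quat and c :: real
  show norm_sqrt: "norm p = sqrt (inner p p)"
    by (simp add: norm_quat_def inner_quat_def power2_eq_square)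
  show "inner p q = inner q p" "inner (p + q) r = inner p r + inner q r"
    "inner (c *\<^sub>R p) q = c * inner p q" "0 \<le> inner p p"
    by (simp_all add: inner_quat_def algebra_simps)
  show "inner p p = 0 \<longleftrightarrow> p = 0"
    using norm_eq_zero [of p] by (simp add: norm_sqrt)
qed

end

instantiation quat :: real_normed_div_algebra
begin

definition inverse_quat :: "quat \<Rightarrow> quat" where
  "inverse p = Quat (qRe p) (- qIm1 p) (- qIm2 p) (- qIm3 p) /\<^sub>R inner p p"

definition divide_quat :: "quat \<Rightarrow> quat \<Rightarrow> quat" where
  "p div (q :: quat) = p * inverse q"

instance
proof
  fix p q :: quat
  have aux: "Quat (qRe p) (- qIm1 p) (- qIm2 p) (- qIm3 p) * p = inner p p *\<^sub>R 1"
    "p * Quat (qRe p) (- qIm1 p) (- qIm2 p) (- qIm3 p) = inner p p *\<^sub>R 1"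
    by (rule iffD2 [OF quat_eq_iff]; simp add: inner_quat_def)+
  show "inverse p * p = 1" "p * inverse p = 1" if "p \<noteq> 0"
    using that by (simp_all add: inverse_quat_def aux)
  show "p div q = p * inverse q" by (rule divide_quat_def)
  show "inverse (0 :: quat) = 0" by (simp add: inverse_quat_def)
  show "norm (p * q) = norm p * norm q"
    unfolding norm_quat_def real_sqrt_mult [symmetric]
    by (rule arg_cong [of _ _ sqrt]) (simp add: power2_eq_square algebra_simps)
qed

end

instantiation quat :: euclidean_space
begin

definition Basis_quat :: "quat set" where
  "Basis = {Quat 1 0 0 0, Quat 0 1 0 0, Quat 0 0 1 0, Quat 0 0 0 1}"

instance
proof
  show "(Basis :: quat set) \<noteq> {}" "finite (Basis :: quat set)"
    by (simp_all add: Basis_quat_def)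
  show "inner u v = (if u = v then 1 else 0)" if "u \<in> Basis" "v \<in> Basis" for u v :: quat
  proof -
    have "\<forall>u\<in>Basis. \<forall>v\<in>Basis. inner u v = (if u = (v :: quat) then 1 else 0)"
      by (simp add: Basis_quat_def inner_quat_def)
    then show ?thesis using that by blast
  qed
  show "(\<forall>u\<in>Basis. inner p u = 0) \<longleftrightarrow> p = 0" for p :: quat
    by (cases p) (simp add: Basis_quat_def inner_quat_def zero_quat_def)
qed

end


section \<open>Slices and symmetric slice domains\<close>

definition imag_units :: "quat set" where
  "imag_units = {I. I * I = - 1}"

definition slice_pt :: "quat \<Rightarrow> real \<Rightarrow> real \<Rightarrow> quat" where
  "slice_pt I x y = of_real x + I * of_real y"

definition slice :: "quat \<Rightarrow> quat set" where
  "slice I = {slice_pt I x y | x y. True}"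

definition domain_in :: "quat set \<Rightarrow> quat set \<Rightarrow> bool" where
  "domain_in X D \<longleftrightarrow> D \<noteq> {} \<and> connected D \<and> openin (top_of_set X) D"

definition symmetric_slice_domain :: "quat set \<Rightarrow> bool" where
  "symmetric_slice_domain D \<longleftrightarrow>
     domain_in UNIV D \<and> D \<inter> \<real> \<noteq> {} \<and>
     (\<forall>I\<in>imag_units. domain_in (slice I) (D \<inter> slice I)) \<and>
     (\<forall>I\<in>imag_units. \<forall>J\<in>imag_units. \<forall>x y. slice_pt I x y \<in> D \<longrightarrow> slice_pt J x y \<in> D)"


section \<open>Regular and slice preserving functions\<close>

text \<open>
  A function with domain \<open>D\<close> is a total function whose values outside \<open>D\<close> are ignored.
  The set \<open>D\<close> is meant to be open; \<open>fx\<close> and \<open>fy\<close> are the partial derivatives of the restriction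
  of \<open>f\<close> to \<open>D \<inter> slice I\<close>.
\<close>

definition regular_on :: "quat set \<Rightarrow> (quat \<Rightarrow> quat) \<Rightarrow> bool" where
  "regular_on D f \<longleftrightarrow>
     (\<forall>I\<in>imag_units. \<exists>fx fy :: real \<times> real \<Rightarrow> quat.
        continuous_on {(x, y). slice_pt I x y \<in> D} fx \<and>
        continuous_on {(x, y). slice_pt I x y \<in> D} fy \<and>
        (\<forall>x y. slice_pt I x y \<in> D \<longrightarrow>
           ((\<lambda>t. f (slice_pt I t y)) has_vector_derivative fx (x, y)) (at x) \<and>
           ((\<lambda>t. f (slice_pt I x t)) has_vector_derivative fy (x, y)) (at y) \<and>
           (1 / 2) *\<^sub>R (fx (x, y) + I * fy (x, y)) = 0))"

definition slice_preserving_on :: "quat set \<Rightarrow> (quat \<Rightarrow> quat) \<Rightarrow> bool" where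
  "slice_preserving_on D f \<longleftrightarrow> (\<forall>I\<in>imag_units. f ` (D \<inter> slice I) \<subseteq> slice I)"

definition entire :: "(quat \<Rightarrow> quat) \<Rightarrow> bool" where
  "entire f \<longleftrightarrow> regular_on UNIV f"


section \<open>Singularities\<close>

definition punctured_disc :: "quat \<Rightarrow> quat \<Rightarrow> real \<Rightarrow> quat set" where
  "punctured_disc I p R = {z \<in> slice I. 0 < norm (z - p) \<and> norm (z - p) < R}"

definition singularity :: "quat set \<Rightarrow> quat \<Rightarrow> quat \<Rightarrow> bool" where
  "singularity A I p \<longleftrightarrow> p \<in> slice I \<and> (\<exists>R>0. punctured_disc I p R \<subseteq> A)"

definition removable_singularity ::
  "quat set \<Rightarrow> (quat \<Rightarrow> quat) \<Rightarrow> quat \<Rightarrow> quat \<Rightarrow> bool" where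
  "removable_singularity A f I p \<longleftrightarrow>
     singularity A I p \<and>
     (\<exists>U g. open U \<and> p \<in> U \<and> regular_on U g \<and> (\<forall>q\<in>U \<inter> A. g q = f q))"

text \<open>
  The bi-infinite series of a Laurent expansion is summed unconditionally over the integers; on an
  open annulus Laurent series converge absolutely, so this is the usual notion of convergence.
\<close>

definition laurent_expansion ::
  "(quat \<Rightarrow> quat) \<Rightarrow> quat \<Rightarrow> quat \<Rightarrow> real \<Rightarrow> (int \<Rightarrow> quat) \<Rightarrow> bool" where
  "laurent_expansion f I p R a \<longleftrightarrow>
     (\<forall>z\<in>punctured_disc I p R. ((\<lambda>n. (z - p) powi n * a n) has_sum f z) UNIV)"

definition pole_at :: "quat set \<Rightarrow> (quat \<Rightarrow> quat) \<Rightarrow> quat \<Rightarrow> quat \<Rightarrow> bool" where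
  "pole_at A f I p \<longleftrightarrow>
     singularity A I p \<and> \<not> removable_singularity A f I p \<and>
     (\<exists>R>0. punctured_disc I p R \<subseteq> A \<and>
        (\<exists>a. laurent_expansion f I p R a \<and> (\<exists>l\<ge>0. \<forall>n>l. a (- n) = 0)))"


section \<open>The algebra of slice preserving semiregular functions\<close>

text \<open>
  \<open>semiregular_with D A f\<close>: \<open>f\<close> is slice preserving regular on \<open>A\<close>, and each point of \<open>D - A\<close> is a
  pole or a removable singularity, viewed in a slice containing it. (A non-real point lies in
  exactly one slice. A real point lies in all of them, and for slice preserving \<open>f\<close> the type of
  its singularity does not depend on the slice.)
\<close>

definition semiregular_with :: "quat set \<Rightarrow> quat set \<Rightarrow> (quat \<Rightarrow> quat) \<Rightarrow> bool" where
  "semiregular_with D A f \<longleftrightarrow>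
     A \<subseteq> D \<and> symmetric_slice_domain A \<and> regular_on A f \<and> slice_preserving_on A f \<and>
     (\<forall>p\<in>D - A. \<exists>I\<in>imag_units. pole_at A f I p \<or> removable_singularity A f I p)"

definition semiregular :: "quat set \<Rightarrow> (quat \<Rightarrow> quat) \<Rightarrow> bool" where
  "semiregular D f \<longleftrightarrow> (\<exists>A. semiregular_with D A f)"

text \<open>
  Identification of functions that agree where both are regular. In particular the (junk) values
  of \<open>f\<close> outside its domain of regularity, e.g. at poles, are irrelevant.
\<close>

definition semiregular_rel :: "quat set \<Rightarrow> ((quat \<Rightarrow> quat) \<times> (quat \<Rightarrow> quat)) set" where
  "semiregular_rel D =
     {(f, g). \<exists>A B. semiregular_with D A f \<and> semiregular_with D B g \<and> (\<forall>q\<in>A \<inter> B. f q = g q)}"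

definition semiregular_class :: "quat set \<Rightarrow> (quat \<Rightarrow> quat) \<Rightarrow> (quat \<Rightarrow> quat) set" where
  "semiregular_class D f = semiregular_rel D `` {f}"

text \<open>
  The real algebra \<open>\<M>\<^sub>s(D)\<close> of equivalence classes, with operations induced by the pointwise
  operations on representatives.
\<close>

definition Ms :: "quat set \<Rightarrow> (real, (quat \<Rightarrow> quat) set) module" where
  "Ms D =
     \<lparr>carrier = {f. semiregular D f} // semiregular_rel D,
      mult = (\<lambda>F G. \<Union>f\<in>F. \<Union>g\<in>G. semiregular_class D (\<lambda>q. f q * g q)),
      one = semiregular_class D (\<lambda>_. 1),
      zero = semiregular_class D (\<lambda>_. 0),
      add = (\<lambda>F G. \<Union>f\<in>F. \<Union>g\<in>G. semiregular_class D (\<lambda>q. f q + g q)),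
      smult = (\<lambda>c F. \<Union>f\<in>F. semiregular_class D (\<lambda>q. c *\<^sub>R f q))\<rparr>"

text \<open>Recall that \<open>ring_hom\<close> consists of unital homomorphisms.\<close>

definition algebra_endomorphism :: "('r, 'a, 'm) module_scheme \<Rightarrow> ('a \<Rightarrow> 'a) \<Rightarrow> bool" where
  "algebra_endomorphism M \<phi> \<longleftrightarrow>
     \<phi> \<in> ring_hom M M \<and>
     (\<forall>c. \<forall>F\<in>carrier M. \<phi> (c \<odot>\<^bsub>M\<^esub> F) = c \<odot>\<^bsub>M\<^esub> \<phi> F)"


section \<open>Composition of a semiregular function with an entire function\<close>

text \<open>\<open>F = \<alpha> / \<beta>\<close>. The values of the quotient at zeros of \<open>\<beta>\<close> do not matter.\<close>

definition entire_quotient ::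
  "(quat \<Rightarrow> quat) set \<Rightarrow> (quat \<Rightarrow> quat) \<Rightarrow> (quat \<Rightarrow> quat) \<Rightarrow> bool" where
  "entire_quotient F \<alpha> \<beta> \<longleftrightarrow>
     entire \<alpha> \<and> slice_preserving_on UNIV \<alpha> \<and>
     entire \<beta> \<and> slice_preserving_on UNIV \<beta> \<and> (\<exists>q. \<beta> q \<noteq> 0) \<and>
     (\<lambda>q. \<alpha> q / \<beta> q) \<in> F"

text \<open>
  \<open>G = F \<circ> h\<close>. The first conjunct keeps the condition from being vacuous, the second makes it
  independent of the chosen quotient. Membership in the class \<open>G\<close> includes that
  \<open>(\<alpha> \<circ> h) / (\<beta> \<circ> h)\<close> is itself a slice preserving semiregular function.
\<close>

definition is_composition ::
  "(quat \<Rightarrow> quat) set \<Rightarrow> (quat \<Rightarrow> quat) set \<Rightarrow> (quat \<Rightarrow> quat) \<Rightarrow> bool" where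
  "is_composition G F h \<longleftrightarrow>
     (\<exists>\<alpha> \<beta>. entire_quotient F \<alpha> \<beta>) \<and>
     (\<forall>\<alpha> \<beta>. entire_quotient F \<alpha> \<beta> \<longrightarrow>
        (\<exists>q. \<beta> (h q) \<noteq> 0) \<and> (\<lambda>q. \<alpha> (h q) / \<beta> (h q)) \<in> G)"

end

theory Submission
  imports "HOL-Complex_Analysis.Complex_Analysis" Defs
begin

text \<open>
  Every slice is a copy of the complex plane, and a slice preserving regular function acts in each
  of these copies as one and the same holomorphic function \<open>F\<close> with \<open>F (cnj z) = cnj (F z)\<close>: on
  the real axis all the copies agree, and the identity theorem does the rest. The singularities
  admitted in a semiregular function are those of a meromorphic function, so the algebra in question is
  the field of conjugation symmetric meromorphic functions on the plane. This identification
  (\<open>semiregular_imp_meromorphic\<close>, \<open>meromorphic_imp_semiregular\<close>, \<open>carrier_Ms\<close>) turns the given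
  endomorphism into an endomorphism \<open>\<psi>\<close> of that field, and the image \<open>h\<close> of the identity function
  under \<open>\<psi>\<close> is the only candidate for the entire function.

  The heart of the matter is that \<open>\<psi>\<close> maps entire functions to entire functions
  (\<open>entire_no_pole\<close>), although \<open>\<psi>\<close> is only known to be algebraic. The argument goes back to
  Iss'sa: divisibility is the algebraic trace of analyticity. There are entire functions
  \<open>P\<^sub>0, P\<^sub>1, P\<^sub>2, \<dots>\<close>, symmetric under conjugation, such that \<open>P\<^sub>n\<close> is the product of a real polynomial
  of degree one and of the power of \<open>P\<^sub>n\<^sub>+\<^sub>1\<close> with exponent \<open>n + 1\<close> (\<open>root_product_rec\<close>). If \<open>\<psi>(f)\<close>
  had a pole of order \<open>k\<close> at \<open>p\<close>, then every polynomial of degree one in \<open>\<psi>(f)\<close> would have the same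
  pole, and the orders \<open>q\<^sub>n\<close> of \<open>\<psi>(P\<^sub>n \<circ> f)\<close> at \<open>p\<close> would be integers with
  \<open>q\<^sub>n = - k + (n + 1) q\<^sub>n\<^sub>+\<^sub>1\<close>. The repeated division forces \<open>q\<^sub>n\<close> to zero, which contradicts
  \<open>k > 0\<close> (\<open>no_divided_integer_orbit\<close>).

  Once \<open>\<psi>(f)\<close> is known to be finite everywhere, its value at \<open>p\<close> can be read off algebraically. With
  \<open>c = h(p)\<close>, an entire symmetric \<open>f\<close> is a real polynomial of degree at most one that takes the value
  \<open>f(c)\<close> at \<open>c\<close>, plus an entire symmetric multiple of the real polynomial \<open>(z - c)(z - cnj c)\<close>
  (\<open>conj_symmetric_division\<close>). Applying \<open>\<psi>\<close> and evaluating at \<open>p\<close> kills the multiple and leaves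
  \<open>f(c)\<close>, so \<open>\<psi>(f) = f \<circ> h\<close> (\<open>entire_eq_compose\<close>). By Weierstrass' factorization theorem every
  symmetric meromorphic function is a quotient of entire symmetric functions
  (\<open>sym_meromorphic_entire_quotient\<close>), and \<open>\<psi>\<close> respects quotients.

  Uniqueness holds because the class of the identity function already determines its composition
  with \<open>h\<close>, that is \<open>h\<close>, off a discrete subset of each slice, and regular functions are continuous on
  slices (\<open>entire_eq_slice_lift\<close>).
\<close>

section \<open>Entire functions with highly divisible zero multiplicities\<close>

text \<open>
  The exponents are the quotients \<open>(n + j)! / n!\<close>, so that passing from \<open>n\<close> to \<open>n + 1\<close> divides all of
    them but the first by \<open>n + 1\<close>. The zeros \<open>2 ^ k * k!\<close> grow faster than the multiplicities, hence the
    product converges without exponential factors.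
\<close>

definition root_product :: "nat \<Rightarrow> complex \<Rightarrow> complex" where
  "root_product n z = (\<Prod>j. (1 - z / of_real (2 ^ (n + j) * fact (n + j))) ^ pochhammer (Suc n) j)"

lemma norm_one_minus_power_minus_one_le:
  fixes w :: complex
  shows "norm ((1 - w) ^ m - 1) \<le> real m * norm w * exp (real m * norm w)"
proof -
  have "norm ((1 - w) ^ m - 1) = norm ((\<Prod>i<m. 1 + (- w)) - 1)"
    by simp
  also have "\<dots> \<le> (\<Prod>i<m. 1 + norm (- w)) - 1"
    by (rule norm_prod_minus1_le_prod_minus1)
  also have "\<dots> = (1 + norm w) ^ m - 1"
    by simp
  also have "\<dots> \<le> exp (norm w) ^ m - 1"
    by (intro diff_right_mono power_mono exp_ge_add_one_self) auto
  also have "\<dots> = exp (real m * norm w) - 1"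
    by (simp add: exp_of_nat_mult)
  also have "\<dots> \<le> real m * norm w * exp (real m * norm w)"
  proof -
    define t where "t = real m * norm w"
    have "1 - t \<le> exp (- t)"
      using exp_ge_add_one_self[of "- t"] by simp
    hence "(1 - t) * exp t \<le> exp (- t) * exp t"
      by (intro mult_right_mono) auto
    thus ?thesis
      unfolding t_def by (simp add: algebra_simps exp_minus)
  qed
  finally show ?thesis .
qed

text \<open>
  The multiplicity \<open>(n + j)! / n!\<close> is at most the factorial in the denominator, so multiplicity
    times modulus decays like \<open>(1 / 2) ^ j\<close>, uniformly on the disc of radius \<open>R\<close>.
\<close>

lemma root_product_factor_bound:
  fixes z :: complex
  assumes "norm z \<le> R"
  shows "norm ((1 - z / of_real (2 ^ (n + j) * fact (n + j))) ^ pochhammer (Suc n) j - 1)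
           \<le> R * exp R * (1 / 2) ^ j"
proof -
  define t where "t = real (pochhammer (Suc n) j) * norm (z / of_real (2 ^ (n + j) * fact (n + j)))"
  have R: "0 \<le> R"
    using assms norm_ge_zero order_trans by blast
  have "(fact (n + j) :: nat) = fact n * pochhammer (Suc n) j"
    by (simp add: pochhammer_fact pochhammer_product' flip: of_nat_Suc)
  hence "pochhammer (Suc n) j \<le> (fact (n + j) :: nat)"
    by (simp add: Suc_le_eq)
  hence "real (pochhammer (Suc n) j) \<le> real (fact (n + j))"
    using of_nat_le_iff by blast
  hence le: "real (pochhammer (Suc n) j) \<le> fact (n + j)"
    by simp
  have "t = (real (pochhammer (Suc n) j) / fact (n + j)) * norm z * (1 / 2) ^ (n + j)"
    by (simp add: t_def norm_divide norm_mult norm_power field_simps)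
  also have "\<dots> \<le> 1 * R * (1 / 2) ^ j"
    using le assms R by (intro mult_mono power_decreasing) auto
  finally have t: "t \<le> R * (1 / 2) ^ j"
    by simp
  have "R * (1 / 2) ^ j \<le> R * 1"
    using R by (intro mult_left_mono power_le_one) auto
  hence "t \<le> R"
    using t by simp
  have "t \<ge> 0"
    by (simp add: t_def)
  have "norm ((1 - z / of_real (2 ^ (n + j) * fact (n + j))) ^ pochhammer (Suc n) j - 1) \<le> t * exp t"
    unfolding t_def by (rule norm_one_minus_power_minus_one_le)
  also have "\<dots> \<le> R * (1 / 2) ^ j * exp R"
    using t \<open>t \<le> R\<close> \<open>t \<ge> 0\<close> R by (intro mult_mono) auto
  finally show ?thesis
    by (simp add: mult_ac)
qed

lemma root_product_convergent:
  fixes z :: complex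
  shows "convergent_prod (\<lambda>j. (1 - z / of_real (2 ^ (n + j) * fact (n + j))) ^ pochhammer (Suc n) j)"
proof (rule abs_convergent_prod_imp_convergent_prod,
    subst abs_convergent_prod_conv_summable, rule summable_comparison_test')
  show "summable (\<lambda>j. norm z * exp (norm z) * (1 / 2) ^ j)"
    by (intro summable_mult summable_geometric) auto
  show "norm (norm ((1 - z / of_real (2 ^ (n + j) * fact (n + j))) ^ pochhammer (Suc n) j - 1))
           \<le> norm z * exp (norm z) * (1 / 2) ^ j" if "0 \<le> j" for j
    using root_product_factor_bound[OF order_refl, of z n j] by simp
qed

lemma root_product_LIMSEQ:
  "(\<lambda>N. \<Prod>j<N. (1 - z / of_real (2 ^ (n + j) * fact (n + j))) ^ pochhammer (Suc n) j)
     \<longlonglongrightarrow> root_product n z"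
  using convergent_prod_LIMSEQ[OF root_product_convergent[of z n]]
  unfolding root_product_def LIMSEQ_lessThan_iff_atMost .

lemma root_product_holomorphic: "root_product n holomorphic_on UNIV"
proof (rule holomorphic_uniform_sequence)
  define f where "f = (\<lambda>j z. (1 - z / of_real (2 ^ (n + j) * fact (n + j)) :: complex) ^ pochhammer (Suc n) j)"
  show "(\<lambda>z. \<Prod>j<N. f j z) holomorphic_on UNIV" for N
    unfolding f_def by (intro holomorphic_intros) auto
  fix z :: complex
  have "uniformly_convergent_on (cball z 1) (\<lambda>N x. \<Prod>j<N. f j x)"
  proof (rule uniformly_convergent_on_prod')
    show "uniformly_convergent_on (cball z 1) (\<lambda>N x. \<Sum>j<N. norm (f j x - 1))"
    proof (rule Weierstrass_m_test')
      show "summable (\<lambda>j. (norm z + 1) * exp (norm z + 1) * (1 / 2) ^ j :: real)"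
        by (intro summable_mult summable_geometric) auto
      fix j x assume "x \<in> cball z 1"
      hence "norm x \<le> norm z + 1"
        using norm_triangle_ineq2[of x z] by (auto simp: dist_norm norm_minus_commute)
      thus "norm (norm (f j x - 1)) \<le> (norm z + 1) * exp (norm z + 1) * (1 / 2) ^ j"
        unfolding f_def using root_product_factor_bound[of x "norm z + 1" n j] by simp
    qed
  qed (auto simp: f_def intro!: continuous_intros)
  then obtain g where g: "uniform_limit (cball z 1) (\<lambda>N x. \<Prod>j<N. f j x) g sequentially"
    by (auto simp: uniformly_convergent_on_def)
  have "g x = root_product n x" if "x \<in> cball z 1" for x
    using tendsto_uniform_limitI[OF g that] root_product_LIMSEQ[of x n] LIMSEQ_unique
    unfolding f_def by blast
  hence "uniform_limit (cball z 1) (\<lambda>N x. \<Prod>j<N. f j x) (root_product n) sequentially"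
    using g uniform_limit_cong'[of "cball z 1" "\<lambda>N x. \<Prod>j<N. f j x" "\<lambda>N x. \<Prod>j<N. f j x" g "root_product n"] by simp
  thus "\<exists>d>0. cball z d \<subseteq> UNIV \<and> uniform_limit (cball z d) (\<lambda>N x. \<Prod>j<N. f j x) (root_product n) sequentially"
    by (intro exI[of _ 1]) auto
qed auto

text \<open>
  The first factor has exponent one and every later exponent is divisible by \<open>n + 1\<close>; what remains
    after taking the root of that degree is the same product started one step later.
\<close>

lemma root_product_rec:
  "root_product n z = (1 - z / of_real (2 ^ n * fact n)) * root_product (Suc n) z ^ Suc n"
proof (rule LIMSEQ_unique)
  show "(\<lambda>N. \<Prod>j<Suc N. (1 - z / of_real (2 ^ (n + j) * fact (n + j))) ^ pochhammer (Suc n) j)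
          \<longlonglongrightarrow> root_product n z"
    using root_product_LIMSEQ[of z n] by (rule LIMSEQ_Suc)
  have "(\<Prod>j<Suc N. (1 - z / of_real (2 ^ (n + j) * fact (n + j))) ^ pochhammer (Suc n) j) =
        (1 - z / of_real (2 ^ n * fact n)) *
        (\<Prod>j<N. (1 - z / of_real (2 ^ (Suc n + j) * fact (Suc n + j))) ^ pochhammer (Suc (Suc n)) j) ^ Suc n" for N
    by (subst prod.lessThan_Suc_shift)
       (simp add: prod_power_distrib pochhammer_rec mult.commute del: power_Suc pochhammer_Suc flip: power_mult)
  thus "(\<lambda>N. \<Prod>j<Suc N. (1 - z / of_real (2 ^ (n + j) * fact (n + j))) ^ pochhammer (Suc n) j)
          \<longlonglongrightarrow> (1 - z / of_real (2 ^ n * fact n)) * root_product (Suc n) z ^ Suc n"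
    by (simp only:) (intro tendsto_intros root_product_LIMSEQ)
qed

lemma root_product_cnj: "root_product n (cnj z) = cnj (root_product n z)"
proof (rule LIMSEQ_unique[OF root_product_LIMSEQ])
  have "(\<lambda>N. cnj (\<Prod>j<N. (1 - z / of_real (2 ^ (n + j) * fact (n + j))) ^ pochhammer (Suc n) j))
          \<longlonglongrightarrow> cnj (root_product n z)"
    by (intro tendsto_intros root_product_LIMSEQ)
  thus "(\<lambda>N. \<Prod>j<N. (1 - cnj z / of_real (2 ^ (n + j) * fact (n + j))) ^ pochhammer (Suc n) j)
          \<longlonglongrightarrow> cnj (root_product n z)"
    by simp
qed

lemma root_product_nonzero:
  assumes "\<And>k. z \<noteq> of_real (2 ^ k * fact k)"
  shows "root_product n z \<noteq> 0"
proof -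
  have "(1 - z / of_real (2 ^ (n + j) * fact (n + j))) ^ pochhammer (Suc n) j \<noteq> 0" for j
    using assms[of "n + j"] by (auto simp: divide_eq_eq)
  thus ?thesis
    unfolding root_product_def using prodinf_nonzero[OF root_product_convergent[of z n]] by blast
qed

text \<open>
  Each step divides by a larger number, so the sequence stays bounded and is eventually of absolute
    value less than one, hence zero. Two consecutive zeros leave \<open>k = 0\<close>.
\<close>

lemma no_divided_integer_orbit:
  fixes q :: "nat \<Rightarrow> int" and k :: int
  assumes "k > 0" and rec: "\<And>n. q n = - k + int (Suc n) * q (Suc n)"
  shows False
proof -
  define M where "M = \<bar>q 1\<bar> + k"
  have step: "int (Suc n) * \<bar>q (Suc n)\<bar> \<le> \<bar>q n\<bar> + k" for n
  proof -
    have "int (Suc n) * \<bar>q (Suc n)\<bar> = \<bar>q n + k\<bar>"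
      using rec[of n] by (simp add: abs_mult)
    thus ?thesis
      using \<open>k > 0\<close> by linarith
  qed
  have bound: "\<bar>q (Suc n)\<bar> \<le> M" for n
  proof (induction n)
    case 0
    thus ?case
      using \<open>k > 0\<close> by (simp add: M_def)
  next
    case (Suc n)
    have "2 * \<bar>q (Suc (Suc n))\<bar> \<le> int (Suc (Suc n)) * \<bar>q (Suc (Suc n))\<bar>"
      by (intro mult_right_mono) auto
    also have "\<dots> \<le> M + k"
      using step[of "Suc n"] Suc by linarith
    also have "k \<le> M"
      by (simp add: M_def)
    finally show ?case
      by linarith
  qed
  have zero: "q (Suc n) = 0" if "n \<ge> nat (M + k + 1)" for n
  proof (rule ccontr)
    assume "q (Suc n) \<noteq> 0"
    hence "int (Suc n) * 1 \<le> int (Suc n) * \<bar>q (Suc n)\<bar>"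
      by (intro mult_left_mono) auto
    hence "int (Suc n) \<le> \<bar>q n\<bar> + k"
      using order_trans[OF _ step[of n]] by simp
    moreover obtain m where "n = Suc m"
      using \<open>n \<ge> nat (M + k + 1)\<close> \<open>k > 0\<close> by (cases n) (auto simp: M_def)
    ultimately show False
      using bound[of m] that by simp
  qed
  show False
    using rec[of "Suc (nat (M + k + 1))"] zero[of "nat (M + k + 1)"] zero[of "Suc (nat (M + k + 1))"] \<open>k > 0\<close>
    by simp
qed

section \<open>Conjugation symmetric meromorphic functions on the plane\<close>

definition conj_symmetric :: "(complex \<Rightarrow> complex) \<Rightarrow> bool" where
  "conj_symmetric F \<longleftrightarrow> (\<forall>z. F (cnj z) = cnj (F z))"

text \<open>
  Values at poles and removable singularities are arbitrary here; functions are compared off a set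
    without accumulation point. Only the symmetry is required at every point, which costs nothing
    and makes evaluation on all slices consistent.
\<close>

definition sym_meromorphic :: "(complex \<Rightarrow> complex) \<Rightarrow> bool" where
  "sym_meromorphic F \<longleftrightarrow> F meromorphic_on UNIV \<and> conj_symmetric F"

lemma eventually_at_if_cosparse: "(\<forall>\<^sub>\<approx>z. P z) \<Longrightarrow> eventually P (at z)"
  by (erule eventually_cosparse_imp_eventually_at) auto

lemma filterlim_cnj_at: "filterlim cnj (at (cnj z)) (at z)"
  by (intro filterlim_atI tendsto_cnj tendsto_ident_at) (auto simp: eventually_at_filter)

lemma eventually_cosparse_cnj:
  assumes "\<forall>\<^sub>\<approx>z. P z"
  shows "\<forall>\<^sub>\<approx>z. P (cnj z)"
proof -
  have "\<forall>\<^sub>F w in at z. P (cnj w)" for z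
    using eventually_at_if_cosparse[OF assms] filterlim_cnj_at by (rule eventually_compose_filterlim)
  thus ?thesis
    by (simp add: eventually_cosparse_open_eq)
qed

lemma sym_meromorphic_holomorphic:
  "F holomorphic_on UNIV \<Longrightarrow> conj_symmetric F \<Longrightarrow> sym_meromorphic F"
  by (simp add: sym_meromorphic_def analytic_on_imp_meromorphic_on analytic_on_open)

lemma sym_meromorphic_const [intro, simp]: "sym_meromorphic (\<lambda>_. of_real c)"
  by (rule sym_meromorphic_holomorphic) (auto simp: conj_symmetric_def)

lemma sym_meromorphic_one [intro, simp]: "sym_meromorphic (\<lambda>_. 1)"
  using sym_meromorphic_const[of 1] by simp

lemma sym_meromorphic_ident [intro, simp]: "sym_meromorphic (\<lambda>z. z)"
  by (rule sym_meromorphic_holomorphic) (auto simp: conj_symmetric_def)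

lemma sym_meromorphic_add [intro, simp]:
  "sym_meromorphic F \<Longrightarrow> sym_meromorphic G \<Longrightarrow> sym_meromorphic (\<lambda>z. F z + G z)"
  by (auto simp: sym_meromorphic_def conj_symmetric_def intro!: meromorphic_intros)

lemma sym_meromorphic_mult [intro, simp]:
  "sym_meromorphic F \<Longrightarrow> sym_meromorphic G \<Longrightarrow> sym_meromorphic (\<lambda>z. F z * G z)"
  by (auto simp: sym_meromorphic_def conj_symmetric_def intro!: meromorphic_intros)

lemma sym_meromorphic_power [intro, simp]:
  "sym_meromorphic F \<Longrightarrow> sym_meromorphic (\<lambda>z. F z ^ n)"
  by (auto simp: sym_meromorphic_def conj_symmetric_def intro!: meromorphic_intros)

lemma sym_meromorphic_inverse [intro, simp]:
  "sym_meromorphic F \<Longrightarrow> sym_meromorphic (\<lambda>z. inverse (F z))"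
  by (auto simp: sym_meromorphic_def conj_symmetric_def intro!: meromorphic_intros)

text \<open>
  Passing from equality almost everywhere to equality: a nicely meromorphic function is determined by
    its germs on punctured neighbourhoods.
\<close>

lemma nicely_meromorphic_eqI:
  assumes "F nicely_meromorphic_on UNIV" "G nicely_meromorphic_on UNIV" "\<forall>\<^sub>\<approx>z. F z = G z"
  shows "F = G"
proof
  fix z
  have ev: "\<forall>\<^sub>F w in at z. F w = G w"
    using assms(3) by (rule eventually_at_if_cosparse)
  have pole: "is_pole F z \<longleftrightarrow> is_pole G z"
    by (rule is_pole_cong) (use ev in auto)
  show "F z = G z"
  proof (cases "is_pole F z")
    case True
    thus ?thesis
      using pole assms is_pole_zero_at_nicely_mero by (metis UNIV_I)
  next
    case False
    hence "F \<midarrow>z\<rightarrow> F z" "G \<midarrow>z\<rightarrow> G z"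
      using pole assms(1,2) unfolding nicely_meromorphic_on_def by auto
    moreover have "F \<midarrow>z\<rightarrow> G z \<longleftrightarrow> G \<midarrow>z\<rightarrow> G z"
      by (rule tendsto_cong) (use ev in auto)
    ultimately show ?thesis
      using LIM_unique by blast
  qed
qed

lemma holomorphic_imp_nicely_meromorphic:
  "F holomorphic_on UNIV \<Longrightarrow> F nicely_meromorphic_on UNIV"
  by (intro analytic_on_imp_nicely_meromorphic_on) (simp add: analytic_on_open)

lemma holomorphic_eqI_cosparse:
  assumes "F holomorphic_on UNIV" "G holomorphic_on UNIV" "\<forall>\<^sub>\<approx>z. F z = G z"
  shows "F = G"
  using assms holomorphic_imp_nicely_meromorphic nicely_meromorphic_eqI by blast

lemma meromorphic_nonzero_cosparse:
  assumes "F meromorphic_on UNIV" "\<not> (\<forall>\<^sub>\<approx>z. F z = 0)"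
  shows "\<forall>\<^sub>\<approx>z. F z \<noteq> 0"
  using meromorphic_imp_constant_or_avoid[OF assms(1), of 0] assms(2) by (auto simp: Convex.connected_UNIV)

lemma holomorphic_nonzero_cosparse:
  assumes "F holomorphic_on UNIV" "F z0 \<noteq> 0"
  shows "\<forall>\<^sub>\<approx>z. F z \<noteq> 0"
proof (rule meromorphic_nonzero_cosparse)
  show "F meromorphic_on UNIV"
    using assms by (simp add: analytic_on_imp_meromorphic_on analytic_on_open)
  show "\<not> (\<forall>\<^sub>\<approx>z. F z = 0)"
    using holomorphic_eqI_cosparse[OF assms(1), of "\<lambda>_. 0"] assms(2) by auto
qed

lemma entire_divide_linear:
  fixes F :: "complex \<Rightarrow> complex"
  assumes "F holomorphic_on UNIV" "F c = 0"
  obtains G where "G holomorphic_on UNIV" "\<And>z. F z = (z - c) * G z" "G c = deriv F c"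
proof
  show "(\<lambda>z. if z = c then deriv F c else (F z - F c) / (z - c)) holomorphic_on UNIV"
    by (rule pole_lemma_open) (use assms in auto)
qed (use assms in auto)

text \<open>
  This is polynomial division by \<open>(z - c) * (z - cnj c)\<close>, carried out over the reals so that both
    the remainder and the quotient stay in the range of a real algebra homomorphism. For real \<open>c\<close> the
    divisor has a double root, and the remainder is the Taylor polynomial.
\<close>

lemma conj_symmetric_division:
  assumes hol: "f holomorphic_on UNIV" and sym: "conj_symmetric f"
  obtains a b :: real and g where
    "g holomorphic_on UNIV" "conj_symmetric g"
    "\<And>z. f z = (of_real a + of_real b * z) +
            (z * z + (of_real (- 2 * Re c) * z + of_real ((norm c)\<^sup>2))) * g z"
proof -
  have quad: "z * z + (of_real (- 2 * Re c) * z + of_real ((norm c)\<^sup>2)) = (z - c) * (z - cnj c)" for z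
  proof -
    have "(z - c) * (z - cnj c) = z * z - (c + cnj c) * z + c * cnj c"
      by (simp add: algebra_simps)
    also have "c + cnj c = of_real (2 * Re c)"
      by (rule complex_add_cnj)
    also have "c * cnj c = of_real ((norm c)\<^sup>2)"
      using complex_norm_square[of c] by simp
    finally show ?thesis
      by simp
  qed
  have sym': "f (cnj z) = cnj (f z)" for z
    using sym by (simp add: conj_symmetric_def)
  \<comment> \<open>The polynomial \<open>a + b * z\<close> interpolates \<open>f\<close> at \<open>c\<close> and \<open>cnj c\<close>; if these coincide,
    it also matches the derivative, which is real by symmetry.\<close>
  define b where "b = (if Im c = 0 then Re (deriv f c) else Im (f c) / Im c)"
  define a where "a = Re (f c) - b * Re c"
  define F where "F = (\<lambda>z. f z - (of_real a + of_real b * z))"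
  have F_hol: "F holomorphic_on UNIV"
    unfolding F_def by (intro holomorphic_intros hol)
  have F_sym: "F (cnj z) = cnj (F z)" for z
    by (simp add: F_def sym')
  have F_c: "F c = 0"
  proof (cases "Im c = 0")
    case True
    hence "cnj c = c"
      by (simp add: complex_eq_iff)
    hence "f c = cnj (f c)"
      using sym'[of c] by simp
    hence "Im (f c) = 0"
      by (simp add: complex_eq_iff)
    thus ?thesis
      using True by (simp add: F_def a_def complex_eq_iff)
  qed (simp add: F_def a_def b_def complex_eq_iff)
  obtain G where G: "G holomorphic_on UNIV" "\<And>z. F z = (z - c) * G z" "G c = deriv F c"
    using entire_divide_linear[OF F_hol F_c] by metis
  have "G (cnj c) = 0"
  proof (cases "Im c = 0")
    case True
    hence cc: "cnj c = c"
      by (simp add: complex_eq_iff)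
    have df: "(f has_field_derivative deriv f c) (at c)"
      using hol by (auto intro: holomorphic_derivI)
    have "(f has_field_derivative cnj (deriv f c)) (at c)"
    proof -
      have "(cnj \<circ> f \<circ> cnj has_field_derivative cnj (deriv f c)) (at c)"
        using df by (intro has_field_derivative_cnj_cnj) (simp add: cc)
      also have "cnj \<circ> f \<circ> cnj = f"
        by (auto simp: fun_eq_iff sym')
      finally show ?thesis .
    qed
    hence "deriv f c = cnj (deriv f c)"
      using df DERIV_unique by blast
    hence "Im (deriv f c) = 0"
      by (simp add: complex_eq_iff)
    moreover have "(F has_field_derivative (deriv f c - of_real b)) (at c)"
      unfolding F_def by (auto intro!: derivative_eq_intros df)
    hence "deriv F c = deriv f c - of_real b"
      by (rule DERIV_imp_deriv)
    ultimately show ?thesis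
      using True by (simp add: cc G(3) b_def complex_eq_iff)
  next
    case False
    moreover have "F (cnj c) = 0"
      using F_sym[of c] F_c by simp
    ultimately show ?thesis
      using G(2)[of "cnj c"] by (simp add: complex_eq_iff)
  qed
  then obtain H where H: "H holomorphic_on UNIV" "\<And>z. G z = (z - cnj c) * H z"
    using entire_divide_linear[OF G(1)] by metis
  \<comment> \<open>Averaging \<open>H\<close> with its reflection, which is a quotient as well, makes the quotient symmetric.\<close>
  define g where "g = (\<lambda>z. (H z + cnj (H (cnj z))) / 2)"
  have FH: "F z = (z - c) * (z - cnj c) * H z" for z
    using G(2) H(2) by simp
  have FH': "F z = (z - c) * (z - cnj c) * cnj (H (cnj z))" for z
    using FH[of "cnj z"] F_sym[of "cnj z"] by (simp add: mult_ac)
  show ?thesis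
  proof
    have "(cnj \<circ> H \<circ> cnj) holomorphic_on UNIV"
      by (rule holomorphic_on_compose_cnj_cnj) (use H(1) in \<open>auto intro: holomorphic_on_subset\<close>)
    thus "g holomorphic_on UNIV"
      unfolding g_def using H(1) by (auto intro!: holomorphic_intros simp: o_def)
    show "conj_symmetric g"
      by (simp add: conj_symmetric_def g_def add.commute)
    fix z
    have "F z = (F z + F z) / 2"
      by simp
    also have "\<dots> = ((z - c) * (z - cnj c) * H z + (z - c) * (z - cnj c) * cnj (H (cnj z))) / 2"
      by (simp only: FH[of z, symmetric] FH'[of z, symmetric])
    also have "\<dots> = (z - c) * (z - cnj c) * g z"
      by (simp add: g_def ring_distribs)
    finally have "F z = (z - c) * (z - cnj c) * g z" .
    hence "f z - (of_real a + of_real b * z) = (z - c) * (z - cnj c) * g z"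
      by (simp only: F_def)
    thus "f z = (of_real a + of_real b * z) +
            (z * z + (of_real (- 2 * Re c) * z + of_real ((norm c)\<^sup>2))) * g z"
      unfolding quad by (simp add: algebra_simps)
  qed
qed

text \<open>
  Weierstrass' theorem gives numerator and denominator without symmetry. Multiplying both by the
    reflection of the denominator makes the denominator symmetric, and the numerator then inherits the
    symmetry from the quotient.
\<close>

lemma sym_meromorphic_entire_quotient:
  assumes "sym_meromorphic F"
  obtains \<alpha> \<beta> where
    "\<alpha> holomorphic_on UNIV" "conj_symmetric \<alpha>" "\<beta> holomorphic_on UNIV" "conj_symmetric \<beta>"
    "\<forall>\<^sub>\<approx>z. \<beta> z \<noteq> 0" "\<forall>\<^sub>\<approx>z. F z = \<alpha> z / \<beta> z"
proof -
  have mero: "F meromorphic_on UNIV" and sym: "\<And>z. F (cnj z) = cnj (F z)"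
    using assms by (auto simp: sym_meromorphic_def conj_symmetric_def)
  obtain h N D where hND: "h holomorphic_on UNIV" "N holomorphic_on UNIV" "D holomorphic_on UNIV"
    "\<forall>z. D z = 0 \<longleftrightarrow> is_pole (remove_sings F) z" "\<forall>z. remove_sings F z = h z * N z / D z"
    using weierstrass_factorization_meromorphic_UNIV[OF remove_sings_nicely_meromorphic[OF mero]]
    by metis
  have D_nz: "\<forall>\<^sub>\<approx>z. D z \<noteq> 0"
    using meromorphic_on_imp_not_pole_cosparse[OF remove_sings_meromorphic[OF mero]] hND(4) by simp
  define D' where "D' = cnj \<circ> D \<circ> cnj"
  have D'_hol: "D' holomorphic_on UNIV"
    unfolding D'_def by (rule holomorphic_on_compose_cnj_cnj) (use hND(3) in \<open>auto intro: holomorphic_on_subset\<close>)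
  define \<beta> where "\<beta> = (\<lambda>z. D z * D' z)"
  define A where "A = (\<lambda>z. h z * N z * D' z)"
  define A' where "A' = cnj \<circ> A \<circ> cnj"
  have A_hol: "A holomorphic_on UNIV"
    unfolding A_def by (intro holomorphic_intros hND D'_hol)
  have A'_hol: "A' holomorphic_on UNIV"
    unfolding A'_def by (rule holomorphic_on_compose_cnj_cnj) (use A_hol in \<open>auto intro: holomorphic_on_subset\<close>)
  have \<beta>_hol: "\<beta> holomorphic_on UNIV"
    unfolding \<beta>_def by (intro holomorphic_intros hND D'_hol)
  obtain z0 where "D z0 \<noteq> 0"
    using eventually_happens[OF eventually_at_if_cosparse[OF D_nz, of 0]] by auto
  hence "D' (cnj z0) \<noteq> 0"
    by (simp add: D'_def)
  hence D'_nz: "\<forall>\<^sub>\<approx>z. D' z \<noteq> 0"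
    by (rule holomorphic_nonzero_cosparse[OF D'_hol])
  have \<beta>_nz: "\<forall>\<^sub>\<approx>z. \<beta> z \<noteq> 0"
    using D_nz D'_nz by eventually_elim (simp add: \<beta>_def)
  have F_eq: "\<forall>\<^sub>\<approx>z. F z = A z / \<beta> z"
    using eventually_remove_sings_eq[OF mero] \<beta>_nz
    by eventually_elim (use hND(5) in \<open>simp add: A_def \<beta>_def\<close>)
  have \<beta>_sym: "conj_symmetric \<beta>"
    by (simp add: conj_symmetric_def \<beta>_def D'_def)
  have "\<forall>\<^sub>\<approx>z. A z = A' z"
    using F_eq eventually_cosparse_cnj[OF F_eq] \<beta>_nz
  proof eventually_elim
    case (elim z)
    have "cnj (A (cnj z) / \<beta> (cnj z)) = cnj (F (cnj z))"
      using elim(2) by simp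
    also have "\<dots> = A z / \<beta> z"
      using sym[of z] elim(1) by simp
    also have "cnj (A (cnj z) / \<beta> (cnj z)) = A' z / \<beta> z"
      using \<beta>_sym by (simp add: A'_def conj_symmetric_def)
    finally show ?case
      using elim(3) by simp
  qed
  hence "A = A'"
    using A_hol A'_hol holomorphic_eqI_cosparse by blast
  hence "A (cnj z) = cnj (A z)" for z
    by (metis A'_def comp_apply complex_cnj_cnj)
  hence "conj_symmetric A"
    by (simp add: conj_symmetric_def)
  thus ?thesis
    using that A_hol \<beta>_hol \<beta>_sym \<beta>_nz F_eq by blast
qed

section \<open>Endomorphisms of the field of symmetric meromorphic functions\<close>

text \<open>
  An \<open>\<real>\<close>-algebra endomorphism, with functions in place of their classes. The values of \<open>\<psi>\<close> are
    normalised to be nicely meromorphic, so that absence of poles means holomorphy.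
\<close>

locale sym_meromorphic_endo =
  fixes \<psi> :: "(complex \<Rightarrow> complex) \<Rightarrow> complex \<Rightarrow> complex"
  assumes sym_meromorphic: "sym_meromorphic F \<Longrightarrow> sym_meromorphic (\<psi> F)"
    and nicely_meromorphic: "sym_meromorphic F \<Longrightarrow> \<psi> F nicely_meromorphic_on UNIV"
    and cong: "sym_meromorphic F \<Longrightarrow> sym_meromorphic G \<Longrightarrow> \<forall>\<^sub>\<approx>z. F z = G z \<Longrightarrow> \<psi> F = \<psi> G"
    and add: "sym_meromorphic F \<Longrightarrow> sym_meromorphic G \<Longrightarrow>
                \<forall>\<^sub>\<approx>z. \<psi> (\<lambda>w. F w + G w) z = \<psi> F z + \<psi> G z"
    and mult: "sym_meromorphic F \<Longrightarrow> sym_meromorphic G \<Longrightarrow>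
                \<forall>\<^sub>\<approx>z. \<psi> (\<lambda>w. F w * G w) z = \<psi> F z * \<psi> G z"
    and const: "\<forall>\<^sub>\<approx>z. \<psi> (\<lambda>_. of_real c) z = of_real c"
begin

text \<open>
  A homomorphism of fields is injective: the inverse goes to an inverse.
\<close>

lemma nonzero:
  assumes "sym_meromorphic F" "\<forall>\<^sub>\<approx>z. F z \<noteq> 0"
  shows "\<forall>\<^sub>\<approx>z. \<psi> F z \<noteq> 0"
proof -
  have "\<forall>\<^sub>\<approx>z. F z * inverse (F z) = of_real 1"
    using assms(2) by eventually_elim auto
  hence "\<psi> (\<lambda>z. F z * inverse (F z)) = \<psi> (\<lambda>_. of_real 1)"
    using assms(1) by (intro cong) auto
  thus ?thesis
    using mult[OF assms(1) sym_meromorphic_inverse[OF assms(1)]] const[of 1]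
    by (auto elim: eventually_elim2)
qed

lemma power:
  assumes "sym_meromorphic F"
  shows "\<forall>\<^sub>\<approx>z. \<psi> (\<lambda>w. F w ^ n) z = \<psi> F z ^ n"
proof (induction n)
  case 0
  thus ?case
    using const[of 1] by simp
next
  case (Suc n)
  show ?case
    using mult[OF assms sym_meromorphic_power[OF assms, of n]] Suc
    by eventually_elim simp
qed

text \<open>
  At a pole of \<open>\<psi> f\<close> all polynomials of degree one in \<open>\<psi> f\<close> have the same negative order, and the
    recursion of \<open>root_product\<close>, composed with \<open>f\<close>, becomes an impossible recursion for integer orders.
\<close>

lemma entire_no_pole:
  assumes hol: "f holomorphic_on UNIV" and sym: "conj_symmetric f"
  shows "\<not> is_pole (\<psi> f) p"
proof
  assume pole: "is_pole (\<psi> f) p"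
  have smf: "sym_meromorphic f"
    using hol sym by (rule sym_meromorphic_holomorphic)
  have mero: "\<psi> F meromorphic_on {p}" if "sym_meromorphic F" for F
    using sym_meromorphic[OF that] meromorphic_on_subset unfolding sym_meromorphic_def by blast
  have nonconst: "\<exists>u v. f u \<noteq> f v"
  proof (rule ccontr)
    assume const_f: "\<nexists>u v. f u \<noteq> f v"
    hence "f 0 = cnj (f 0)"
      using sym by (metis conj_symmetric_def)
    hence "f 0 = of_real (Re (f 0))"
      by (simp add: complex_eq_iff)
    hence "f = (\<lambda>_. of_real (Re (f 0)))"
      using const_f by metis
    hence "\<forall>\<^sub>\<approx>z. \<psi> f z = of_real (Re (f 0))"
      using const by metis
    hence "\<forall>\<^sub>F z in at p. \<psi> f z = of_real (Re (f 0))"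
      by (rule eventually_at_if_cosparse)
    hence "is_pole (\<psi> f) p \<longleftrightarrow> is_pole (\<lambda>_. of_real (Re (f 0)) :: complex) p"
      by (intro is_pole_cong) auto
    thus False
      using pole by simp
  qed
  \<comment> \<open>The image of \<open>f\<close> is connected and not a point, so it is uncountable and contains a point
    that is not among the zeros of the products. Hence no \<open>P\<^sub>n \<circ> f\<close> vanishes identically.\<close>
  obtain z0 where z0: "\<And>k. f z0 \<noteq> of_real (2 ^ k * fact k)"
  proof -
    have "connected (range f)"
      using hol by (intro connected_continuous_image holomorphic_on_imp_continuous_on) auto
    hence "uncountable (range f)"
      using nonconst connected_uncountable[of "range f"] by blast
    hence "\<not> range f \<subseteq> range (\<lambda>k. of_real (2 ^ k * fact k))"
      using countable_subset by blast
    thus ?thesis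
      using that by blast
  qed
  define G where "G = (\<lambda>n z. root_product n (f z))"
  have G_hol: "G n holomorphic_on UNIV" for n
    using holomorphic_on_compose[OF hol holomorphic_on_subset[OF root_product_holomorphic[of n]]]
    by (simp add: G_def o_def)
  have smG: "sym_meromorphic (G n)" for n
    using G_hol sym by (intro sym_meromorphic_holomorphic) (auto simp: conj_symmetric_def G_def root_product_cnj)
  have "\<forall>\<^sub>\<approx>z. G n z \<noteq> 0" for n
    using G_hol by (rule holomorphic_nonzero_cosparse[where ?z0.0 = z0]) (simp add: G_def root_product_nonzero[OF z0])
  hence "\<forall>\<^sub>\<approx>z. \<psi> (G n) z \<noteq> 0" for n
    using smG by (intro nonzero)
  hence nz: "\<exists>\<^sub>F z in at p. \<psi> (G n) z \<noteq> 0" for n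
    by (intro eventually_frequently eventually_at_if_cosparse) auto
  define k where "k = - zorder (\<psi> f) p"
  have "isolated_singularity_at (\<psi> f) p"
    using mero[OF smf] by (simp add: meromorphic_at_iff)
  hence "k > 0"
    using isolated_pole_imp_neg_zorder[of "\<psi> f" p] pole by (simp add: k_def)
  have nzf: "\<exists>\<^sub>F z in at p. \<psi> f z \<noteq> 0"
    using non_zero_neighbour_pole[OF pole] by (intro eventually_frequently) auto
  have "zorder (\<psi> (G n)) p = - k + int (Suc n) * zorder (\<psi> (G (Suc n))) p" for n
  proof -
    define c :: real where "c = - (1 / (2 ^ n * fact n))"
    have c: "c \<noteq> 0"
      by (simp add: c_def)
    define L where "L = (\<lambda>z. of_real 1 + of_real c * f z)"
    have smL: "sym_meromorphic L"
      unfolding L_def by (intro sym_meromorphic_add sym_meromorphic_mult sym_meromorphic_const smf)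
    have "G n = (\<lambda>z. L z * G (Suc n) z ^ Suc n)"
      by (simp add: fun_eq_iff G_def L_def c_def root_product_rec[of n] del: power_Suc)
    hence "\<forall>\<^sub>\<approx>z. \<psi> (G n) z = \<psi> L z * \<psi> (\<lambda>z. G (Suc n) z ^ Suc n) z"
      using mult[OF smL sym_meromorphic_power[OF smG[of "Suc n"], of "Suc n"]] by simp
    moreover have "\<forall>\<^sub>\<approx>z. \<psi> L z = \<psi> (\<lambda>_. of_real 1) z + \<psi> (\<lambda>z. of_real c * f z) z"
      unfolding L_def by (intro add sym_meromorphic_mult sym_meromorphic_const smf)
    ultimately have eq: "\<forall>\<^sub>\<approx>z. \<psi> (G n) z = (1 + of_real c * \<psi> f z) * \<psi> (G (Suc n)) z ^ Suc n"
      using const[of 1] const[of c] mult[OF sym_meromorphic_const[of c] smf] power[OF smG[of "Suc n"], of "Suc n"]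
      by eventually_elim simp
    have c_order: "zorder (\<lambda>z. of_real c * \<psi> f z) p = - k"
      unfolding k_def using c by (simp add: zorder_cmult)
    have c_nz: "\<exists>\<^sub>F z in at p. of_real c * \<psi> f z \<noteq> 0"
      using nzf c by simp
    have L_pole: "zorder (\<lambda>z. 1 + of_real c * \<psi> f z) p = - k"
    proof -
      have "zorder (\<lambda>z. of_real c * \<psi> f z) p < zorder (\<lambda>_. 1) p"
        using c_order \<open>k > 0\<close> by simp
      moreover have "(\<lambda>z. of_real c * \<psi> f z) meromorphic_on {p}"
        by (intro meromorphic_intros mero smf)
      ultimately show ?thesis
        using zorder_add2[of "\<lambda>_. 1" p "\<lambda>z. of_real c * \<psi> f z"] c_order c_nz
        by (simp add: meromorphic_on_const)
    qed
    have L_nz: "\<exists>\<^sub>F z in at p. 1 + of_real c * \<psi> f z \<noteq> 0"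
    proof -
      have "filterlim (\<lambda>z. 1 + of_real c * \<psi> f z) at_infinity (at p)"
        using pole c unfolding is_pole_def
        by (intro tendsto_add_filterlim_at_infinity[OF tendsto_const]
              tendsto_mult_filterlim_at_infinity[OF tendsto_const]) auto
      hence "is_pole (\<lambda>z. 1 + of_real c * \<psi> f z) p"
        by (simp add: is_pole_def)
      from non_zero_neighbour_pole[OF this] show ?thesis
        by (intro eventually_frequently) auto
    qed
    have "zorder (\<psi> (G n)) p = zorder (\<lambda>z. (1 + of_real c * \<psi> f z) * \<psi> (G (Suc n)) z ^ Suc n) p"
      by (rule zorder_cong[OF eventually_at_if_cosparse[OF eq] refl])
    also have "\<dots> = - k + zorder (\<lambda>z. \<psi> (G (Suc n)) z ^ Suc n) p"
      using nz[of "Suc n"] L_nz mero[OF smf] mero[OF smG] L_pole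
      by (subst zorder_mult) (auto intro!: meromorphic_intros simp del: power_Suc)
    also have "zorder (\<lambda>z. \<psi> (G (Suc n)) z ^ Suc n) p = int (Suc n) * zorder (\<psi> (G (Suc n))) p"
      by (rule zorder_power[OF mero[OF smG] nz])
    finally show ?thesis .
  qed
  thus False
    by (rule no_divided_integer_orbit[OF \<open>k > 0\<close>])
qed

lemma entire:
  assumes "f holomorphic_on UNIV" "conj_symmetric f"
  shows "\<psi> f holomorphic_on UNIV" "conj_symmetric (\<psi> f)"
proof -
  have smf: "sym_meromorphic f"
    using assms by (rule sym_meromorphic_holomorphic)
  show "\<psi> f holomorphic_on UNIV"
    using nicely_meromorphic_without_singularities[OF nicely_meromorphic[OF smf]]
      entire_no_pole[OF assms] analytic_imp_holomorphic by blast
  show "conj_symmetric (\<psi> f)"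
    using sym_meromorphic[OF smf] by (simp add: sym_meromorphic_def)
qed

text \<open>
  Division with remainder at \<open>c = h p\<close>: the image of the divisor vanishes at \<open>p\<close>, and because the
    image of the quotient is finite there, only the remainder contributes.
\<close>

lemma entire_eq_compose:
  assumes hol: "f holomorphic_on UNIV" and sym: "conj_symmetric f"
  shows "\<psi> f p = f (\<psi> (\<lambda>z. z) p)"
proof -
  define h where "h = \<psi> (\<lambda>z. z)"
  define c where "c = h p"
  obtain a b g where g: "g holomorphic_on UNIV" "conj_symmetric g"
    and f_eq: "\<And>z. f z = (of_real a + of_real b * z) +
            (z * z + (of_real (- 2 * Re c) * z + of_real ((norm c)\<^sup>2))) * g z"
    using conj_symmetric_division[OF hol sym, where c = c] by metis
  have smg: "sym_meromorphic g"
    using g by (rule sym_meromorphic_holomorphic)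
  define l where "l = (\<lambda>z. of_real a + of_real b * z :: complex)"
  define m where "m = (\<lambda>z. of_real (- 2 * Re c) * z + of_real ((norm c)\<^sup>2) :: complex)"
  define d where "d = (\<lambda>z. z * z + m z :: complex)"
  have sml: "sym_meromorphic l"
    unfolding l_def by (intro sym_meromorphic_add sym_meromorphic_mult sym_meromorphic_const sym_meromorphic_ident)
  have smm: "sym_meromorphic m"
    unfolding m_def by (intro sym_meromorphic_add sym_meromorphic_mult sym_meromorphic_const sym_meromorphic_ident)
  have smd: "sym_meromorphic d"
    unfolding d_def by (intro sym_meromorphic_add sym_meromorphic_mult smm sym_meromorphic_ident)
  have f_eq': "f = (\<lambda>z. l z + d z * g z)"
    using f_eq by (auto simp: fun_eq_iff l_def m_def d_def)
  have linear: "\<forall>\<^sub>\<approx>z. \<psi> (\<lambda>z. of_real s * z) z = of_real s * h z" for s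
    using mult[OF sym_meromorphic_const[of s] sym_meromorphic_ident] const[of s]
    by eventually_elim (simp add: h_def)
  have psi_l: "\<forall>\<^sub>\<approx>z. \<psi> l z = of_real a + of_real b * h z"
    unfolding l_def
    using add[OF sym_meromorphic_const[of a] sym_meromorphic_mult[OF sym_meromorphic_const[of b] sym_meromorphic_ident]]
      const[of a] linear[of b]
    by eventually_elim simp
  have psi_m: "\<forall>\<^sub>\<approx>z. \<psi> m z = of_real (- 2 * Re c) * h z + of_real ((norm c)\<^sup>2)"
    unfolding m_def
    using add[OF sym_meromorphic_mult[OF sym_meromorphic_const[of "- 2 * Re c"] sym_meromorphic_ident]
        sym_meromorphic_const[of "(norm c)\<^sup>2"]]
      const[of "(norm c)\<^sup>2"] linear[of "- 2 * Re c"]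
    by eventually_elim (simp del: of_real_mult)
  have psi_d: "\<forall>\<^sub>\<approx>z. \<psi> d z = h z * h z + (of_real (- 2 * Re c) * h z + of_real ((norm c)\<^sup>2))"
    unfolding d_def
    using add[OF sym_meromorphic_mult[OF sym_meromorphic_ident sym_meromorphic_ident] smm]
      mult[OF sym_meromorphic_ident sym_meromorphic_ident] psi_m
    by eventually_elim (simp add: h_def)
  have "\<forall>\<^sub>\<approx>z. \<psi> f z = (of_real a + of_real b * h z) +
            (h z * h z + (of_real (- 2 * Re c) * h z + of_real ((norm c)\<^sup>2))) * \<psi> g z"
    using add[OF sml sym_meromorphic_mult[OF smd smg]] mult[OF smd smg] psi_l psi_d
    unfolding f_eq' by eventually_elim simp
  moreover have "h holomorphic_on UNIV"
    unfolding h_def by (rule entire) (auto simp: conj_symmetric_def)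
  ultimately have "\<psi> f = (\<lambda>z. (of_real a + of_real b * h z) +
            (h z * h z + (of_real (- 2 * Re c) * h z + of_real ((norm c)\<^sup>2))) * \<psi> g z)"
    using entire(1)[OF hol sym] entire(1)[OF g]
    by (intro holomorphic_eqI_cosparse) (auto intro!: holomorphic_intros)
  moreover have "c * c + (of_real (- 2 * Re c) * c + of_real ((norm c)\<^sup>2)) = 0"
    unfolding cmod_power2 by (simp add: complex_eq_iff power2_eq_square algebra_simps)
  ultimately show ?thesis
    using f_eq[of c] by (simp add: c_def flip: h_def)
qed

end

section \<open>Slices and regular functions in complex coordinates\<close>

text \<open>
  The isomorphism of the complex plane with a slice, sending \<open>\<i>\<close> to the chosen unit \<open>I\<close>.
\<close>

definition emb :: "quat \<Rightarrow> complex \<Rightarrow> quat" where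
  "emb I z = slice_pt I (Re z) (Im z)"

text \<open>
  The real linear left inverse of \<open>emb I\<close>, given by the component of a quaternion in the slice. It is
    defined on all quaternions because derivatives and Laurent coefficients are not known in advance
    to lie in the slice.
\<close>

definition proj :: "quat \<Rightarrow> quat \<Rightarrow> complex" where
  "proj I q = Complex (qRe q) (inner I q)"

lemma of_real_quat_sel [simp]:
  "qRe (of_real x) = x" "qIm1 (of_real x) = 0" "qIm2 (of_real x) = 0" "qIm3 (of_real x) = 0"
  by (simp_all add: of_real_def)

text \<open>
  The vector part of \<open>I * I\<close> is the vector part of \<open>I\<close> times twice its real part, so if the real part
    is nonzero and \<open>I * I = - 1\<close>, then \<open>I\<close> is real; but real squares are not negative.
\<close>

lemma imag_units_iff: "I \<in> imag_units \<longleftrightarrow> qRe I = 0 \<and> norm I = 1"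
proof -
  have "I * I = - 1 \<longleftrightarrow> qRe I = 0 \<and> (qIm1 I)\<^sup>2 + (qIm2 I)\<^sup>2 + (qIm3 I)\<^sup>2 = 1"
  proof (cases "qRe I = 0")
    case False
    hence "(qRe I)\<^sup>2 > 0"
      by simp
    moreover have "(qRe I)\<^sup>2 = - 1" if "qIm1 I = 0" "qIm2 I = 0" "qIm3 I = 0" "I * I = - 1"
      using that by (simp add: quat_eq_iff power2_eq_square)
    moreover have "qIm1 I = 0 \<and> qIm2 I = 0 \<and> qIm3 I = 0" if "I * I = - 1"
      using that False by (simp add: quat_eq_iff)
    ultimately show ?thesis
      using False by fastforce
  qed (auto simp: quat_eq_iff power2_eq_square)
  thus ?thesis
    by (auto simp: imag_units_def norm_quat_def)
qed

lemma imag_unitsD: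
  assumes "I \<in> imag_units"
  shows "qRe I = 0" "norm I = 1" "qIm1 I * qIm1 I + qIm2 I * qIm2 I + qIm3 I * qIm3 I = 1"
  using assms by (auto simp: imag_units_iff norm_quat_def power2_eq_square)

lemma uminus_imag_units [simp]: "- I \<in> imag_units \<longleftrightarrow> I \<in> imag_units"
  by (simp add: imag_units_iff)

lemma imag_units_nonempty: "Quat 0 1 0 0 \<in> imag_units"
  by (simp add: imag_units_iff norm_quat_def)

lemma linear_emb: "linear (emb I)"
  by (rule linearI) (simp_all add: emb_def slice_pt_def quat_eq_iff algebra_simps)

lemma bounded_linear_emb: "bounded_linear (emb I)"
  using linear_emb linear_conv_bounded_linear by blast

lemma linear_proj: "linear (proj I)"
  by (rule linearI) (simp_all add: proj_def complex_eq_iff inner_add_right)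

lemma bounded_linear_proj: "bounded_linear (proj I)"
  using linear_proj linear_conv_bounded_linear by blast

lemma emb_zero [simp]: "emb I 0 = 0"
  by (rule linear_0[OF linear_emb])

lemma emb_one [simp]: "emb I 1 = 1"
  by (simp add: emb_def slice_pt_def quat_eq_iff)

lemma emb_of_real [simp]: "emb I (of_real x) = of_real x"
  by (simp add: emb_def slice_pt_def quat_eq_iff)

lemma emb_add: "emb I (z + w) = emb I z + emb I w"
  by (rule linear_add[OF linear_emb])

lemma emb_diff: "emb I (z - w) = emb I z - emb I w"
  by (rule linear_diff[OF linear_emb])

lemma emb_uminus: "emb (- I) z = emb I (cnj z)"
  by (simp add: emb_def slice_pt_def)

lemma slice_pt_eq_emb: "slice_pt I x y = emb I (Complex x y)"
  by (simp add: emb_def)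

lemma slice_eq_range_emb: "slice I = range (emb I)"
proof -
  have "emb I z \<in> slice I" for z
    unfolding slice_def emb_def by blast
  moreover have "q \<in> range (emb I)" if "q \<in> slice I" for q
    using that unfolding slice_def slice_pt_eq_emb by blast
  ultimately show ?thesis
    by blast
qed

context
  fixes I assumes I: "I \<in> imag_units"
begin

lemma emb_mult: "emb I (z * w) = emb I z * emb I w"
proof -
  have e: "emb I u = Re u *\<^sub>R 1 + Im u *\<^sub>R I" for u
    by (simp add: emb_def slice_pt_def quat_eq_iff)
  have "I * I = - 1"
    using I by (simp add: imag_units_def)
  thus ?thesis
    by (simp add: e distrib_left distrib_right scaleR_left_distrib scaleR_left_diff_distrib
        scaleR_right_distrib scaleR_right_diff_distrib mult.commute)
qed

lemma norm_emb [simp]: "norm (emb I z) = norm z"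
proof -
  have "(qIm1 I)\<^sup>2 + (qIm2 I)\<^sup>2 + (qIm3 I)\<^sup>2 = 1"
    using imag_unitsD(3)[OF I] by (simp add: power2_eq_square)
  hence "(Re z)\<^sup>2 + (Im z * qIm1 I)\<^sup>2 + (Im z * qIm2 I)\<^sup>2 + (Im z * qIm3 I)\<^sup>2 = (Re z)\<^sup>2 + (Im z)\<^sup>2"
    by (simp add: power_mult_distrib add.assoc flip: distrib_left)
  thus ?thesis
    using imag_unitsD(1)[OF I]
    by (simp add: norm_quat_def cmod_def emb_def slice_pt_def mult.commute)
qed

lemma emb_eq_0_iff [simp]: "emb I z = 0 \<longleftrightarrow> z = 0"
  by (metis norm_emb norm_eq_zero)

lemma emb_inj [simp]: "emb I z = emb I w \<longleftrightarrow> z = w"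
  using emb_eq_0_iff[of "z - w"] by (simp add: emb_diff)

lemma emb_inverse: "emb I (inverse z) = inverse (emb I z)"
proof (cases "z = 0")
  case False
  hence "emb I z * emb I (inverse z) = 1"
    by (simp flip: emb_mult)
  thus ?thesis
    by (metis inverse_unique)
qed simp

lemma emb_divide: "emb I (z / w) = emb I z / emb I w"
  by (simp add: divide_inverse emb_mult emb_inverse)

lemma emb_power: "emb I (z ^ n) = emb I z ^ n"
  by (induction n) (simp_all add: emb_mult)

lemma emb_power_int: "emb I (z powi n) = emb I z powi n"
  by (cases "n \<ge> 0") (auto simp: power_int_def emb_power emb_inverse power_inverse)

lemma emb_ii: "emb I \<i> = I"
  by (simp add: emb_def slice_pt_def)

lemma proj_emb [simp]: "proj I (emb I z) = z"
proof -
  have "qRe (emb I z) = Re z" "inner I (emb I z) = Im z"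
    using imag_unitsD[OF I]
    by (simp_all add: emb_def slice_pt_def inner_quat_def flip: mult.assoc distrib_right)
  thus ?thesis
    by (simp add: proj_def)
qed

text \<open>
  Multiplication by elements of a slice respects the splitting of the quaternions into the slice and its
    orthogonal complement, so \<open>proj I\<close> is complex linear and transports complex power series.
\<close>

lemma proj_mult: "proj I (emb I z * q) = z * proj I q"
proof -
  have lin: "inner I (I * q) = qRe q"
  proof -
    have "inner I (I * q) = (qIm1 I * qIm1 I + qIm2 I * qIm2 I + qIm3 I * qIm3 I) * qRe q"
      using imag_unitsD(1)[OF I] by (simp add: inner_quat_def algebra_simps)
    thus ?thesis
      using imag_unitsD(3)[OF I] by simp
  qed
  have "qRe (I * q) = - inner I q"
    using imag_unitsD(1)[OF I] by (simp add: inner_quat_def)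
  hence i: "proj I (I * q) = \<i> * proj I q"
    by (simp add: proj_def lin complex_eq_iff)
  have "emb I z * q = Re z *\<^sub>R q + Im z *\<^sub>R (I * q)"
    by (simp add: emb_def slice_pt_def quat_eq_iff algebra_simps)
  hence "proj I (emb I z * q) = Re z *\<^sub>R proj I q + Im z *\<^sub>R (\<i> * proj I q)"
    by (simp add: linear_add[OF linear_proj] linear_scale[OF linear_proj] i)
  also have "\<dots> = z * proj I q"
    by (simp add: complex_eq_iff)
  finally show ?thesis .
qed

lemma proj_uminus: "proj (- I) q = cnj (proj I q)"
  by (simp add: proj_def complex_eq_iff)

lemma emb_proj: "q \<in> slice I \<Longrightarrow> emb I (proj I q) = q"
  unfolding slice_eq_range_emb by auto

end

text \<open>
  Continuous partial derivatives give a total derivative, which is the input for complex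
    differentiability and for continuity of a regular function on a slice.
\<close>

lemma regular_on_has_derivative:
  assumes reg: "regular_on D f" and D: "open D" and I: "I \<in> imag_units" and z: "emb I z \<in> D"
  obtains a b where "((\<lambda>w. f (emb I w)) has_derivative (\<lambda>w. Re w *\<^sub>R a + Im w *\<^sub>R b)) (at z)"
    "a + I * b = 0"
proof -
  define T where "T = {(x, y). slice_pt I x y \<in> D}"
  obtain fx fy where cont: "continuous_on T fy"
    and fx: "\<And>x y. (x, y) \<in> T \<Longrightarrow> ((\<lambda>t. f (slice_pt I t y)) has_vector_derivative fx (x, y)) (at x)"
    and fy: "\<And>x y. (x, y) \<in> T \<Longrightarrow> ((\<lambda>t. f (slice_pt I x t)) has_vector_derivative fy (x, y)) (at y)"
    and eq: "\<And>x y. (x, y) \<in> T \<Longrightarrow> (1 / 2) *\<^sub>R (fx (x, y) + I * fy (x, y)) = 0"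
    using reg I unfolding regular_on_def T_def by blast
  have "T = (\<lambda>p. slice_pt I (fst p) (snd p)) -` D"
    by (auto simp: T_def)
  moreover have "continuous_on UNIV (\<lambda>p. slice_pt I (fst p) (snd p))"
    unfolding slice_pt_def by (intro continuous_intros)
  ultimately have T: "open T"
    using D by (simp add: continuous_on_open_vimage)
  have zT: "(Re z, Im z) \<in> T"
    using z by (simp add: T_def emb_def)
  obtain A B where AB: "open A" "open B" "Re z \<in> A" "Im z \<in> B" "A \<times> B \<subseteq> T"
    using T zT by (metis mem_Sigma_iff open_prod_elim)
  obtain e where e: "e > 0" "ball (Im z) e \<subseteq> B"
    using AB(2,4) openE by blast
  define Y where "Y = ball (Im z) e"
  have Y: "open Y" "Im z \<in> Y" "A \<times> Y \<subseteq> T"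
    using e AB(5) unfolding Y_def by auto
  have at: "at (Re z, Im z) within A \<times> Y = at (Re z, Im z)"
    using AB Y by (intro at_within_open) (auto intro: open_Times)
  have "((\<lambda>(x, y). f (slice_pt I x y)) has_derivative
          (\<lambda>(tx, ty). tx *\<^sub>R fx (Re z, Im z) + blinfun_apply (blinfun_scaleR_left (fy (Re z, Im z))) ty))
          (at (Re z, Im z) within A \<times> Y)"
  proof (rule has_derivative_partialsI)
    show "((\<lambda>x. f (slice_pt I x (Im z))) has_derivative (\<lambda>tx. tx *\<^sub>R fx (Re z, Im z))) (at (Re z) within A)"
      using fx[OF zT] unfolding has_vector_derivative_def by (rule has_derivative_at_withinI)
    show "((\<lambda>y. f (slice_pt I x y)) has_derivative blinfun_apply (blinfun_scaleR_left (fy (x, y)))) (at y within Y)"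
      if "x \<in> A" "y \<in> Y" for x y
      using fy[of x y] that Y(3) unfolding has_vector_derivative_def
      by (auto intro: has_derivative_at_withinI)
    have "continuous_on (A \<times> Y) (\<lambda>p. blinfun_scaleR_left (fy p))"
      using continuous_on_subset[OF cont Y(3)]
      by (intro bounded_linear.continuous_on[OF bounded_linear_blinfun_scaleR_left])
    thus "continuous (at (Re z, Im z) within A \<times> Y) (\<lambda>(x, y). blinfun_scaleR_left (fy (x, y)))"
      using AB(3) Y(2) by (simp add: continuous_on_eq_continuous_within case_prod_unfold)
  qed (use Y in \<open>auto simp: Y_def\<close>)
  hence deriv: "((\<lambda>(x, y). f (slice_pt I x y)) has_derivative
          (\<lambda>(tx, ty). tx *\<^sub>R fx (Re z, Im z) + ty *\<^sub>R fy (Re z, Im z))) (at (Re z, Im z))"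
    unfolding at by simp
  have "((\<lambda>w. (Re w, Im w)) has_derivative (\<lambda>w. (Re w, Im w))) (at z)"
    by (intro has_derivative_Pair bounded_linear_imp_has_derivative bounded_linear_Re bounded_linear_Im)
  from diff_chain_at[OF this deriv]
  have "((\<lambda>w. f (emb I w)) has_derivative (\<lambda>w. Re w *\<^sub>R fx (Re z, Im z) + Im w *\<^sub>R fy (Re z, Im z))) (at z)"
    by (simp add: o_def emb_def)
  moreover have "fx (Re z, Im z) + I * fy (Re z, Im z) = 0"
    using eq[OF zT] by simp
  ultimately show ?thesis
    using that by blast
qed

lemma regular_on_isCont:
  assumes "regular_on D f" "open D" "I \<in> imag_units" "emb I z \<in> D"
  shows "isCont (\<lambda>w. f (emb I w)) z"
  using regular_on_has_derivative[OF assms] has_derivative_continuous by metis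

lemma open_emb_preimage: "open D \<Longrightarrow> open {z. emb I z \<in> D}"
  using open_vimage[of D "emb I"] linear_continuous_on[OF bounded_linear_emb, of UNIV I]
  by (simp add: vimage_def)

text \<open>
  The regularity equation makes the total derivative commute with \<open>I\<close>, and \<open>proj I\<close> turns this into the
    Cauchy-Riemann equations.
\<close>

lemma regular_on_proj_holomorphic:
  assumes reg: "regular_on D f" and D: "open D" and I: "I \<in> imag_units"
  shows "(\<lambda>z. proj I (f (emb I z))) holomorphic_on {z. emb I z \<in> D}"
proof -
  have "(\<lambda>z. proj I (f (emb I z))) field_differentiable at z" if z: "emb I z \<in> D" for z
  proof -
    obtain a b where d: "((\<lambda>w. f (emb I w)) has_derivative (\<lambda>w. Re w *\<^sub>R a + Im w *\<^sub>R b)) (at z)"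
      and ab: "a + I * b = 0"
      using regular_on_has_derivative[OF reg D I z] by metis
    have "I * a = I * (a + I * b) + b"
      using I by (simp add: distrib_left imag_units_def flip: mult.assoc)
    hence "b = emb I \<i> * a"
      using ab I by (simp add: emb_ii)
    hence b: "proj I b = \<i> * proj I a"
      using I by (simp add: proj_mult)
    have "((\<lambda>w. proj I (f (emb I w))) has_derivative (\<lambda>w. proj I (Re w *\<^sub>R a + Im w *\<^sub>R b))) (at z)"
      using d by (rule bounded_linear.has_derivative[OF bounded_linear_proj])
    moreover have "proj I (Re w *\<^sub>R a + Im w *\<^sub>R b) = proj I a * w" for w
      by (simp add: linear_add[OF linear_proj] linear_scale[OF linear_proj] b) (simp add: complex_eq_iff)
    ultimately have "((\<lambda>w. proj I (f (emb I w))) has_field_derivative proj I a) (at z)"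
      unfolding has_field_derivative_def by simp
    thus ?thesis
      by (auto simp: field_differentiable_def)
  qed
  thus ?thesis
    by (auto simp: holomorphic_on_def intro: field_differentiable_at_within)
qed

lemma regular_onI_holomorphic:
  assumes D: "open D" and S: "open S" and hol: "F holomorphic_on S"
    and eq: "\<And>I z. I \<in> imag_units \<Longrightarrow> emb I z \<in> D \<Longrightarrow> z \<in> S \<and> f (emb I z) = emb I (F z)"
  shows "regular_on D f"
  unfolding regular_on_def
proof
  fix I assume I: "I \<in> imag_units"
  define T where "T = {(x, y). slice_pt I x y \<in> D}"
  define fx where "fx = (\<lambda>(x, y). emb I (deriv F (Complex x y)))"
  define fy where "fy = (\<lambda>(x, y). emb I (\<i> * deriv F (Complex x y)))"
  have TS: "Complex x y \<in> S" if "(x, y) \<in> T" for x y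
    using that eq[OF I, of "Complex x y"] by (simp add: T_def emb_def)
  have cont: "continuous_on T (\<lambda>p. deriv F (Complex (fst p) (snd p)))"
  proof (rule continuous_on_compose2[where g = "deriv F" and t = S])
    show "continuous_on S (deriv F)"
      using holomorphic_deriv[OF hol S] by (rule holomorphic_on_imp_continuous_on)
    have "(\<lambda>p. Complex (fst p) (snd p)) = (\<lambda>p. of_real (fst p) + \<i> * of_real (snd p))"
      by (simp add: Complex_eq)
    thus "continuous_on T (\<lambda>p. Complex (fst p) (snd p))"
      by (auto intro!: continuous_intros)
  qed (use TS in auto)
  have "continuous_on T fx"
    unfolding fx_def case_prod_unfold by (intro bounded_linear.continuous_on[OF bounded_linear_emb] cont)
  moreover have "continuous_on T fy"
    unfolding fy_def case_prod_unfold
    by (intro bounded_linear.continuous_on[OF bounded_linear_emb] continuous_intros cont)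
  moreover have "((\<lambda>t. f (slice_pt I t y)) has_vector_derivative fx (x, y)) (at x) \<and>
           ((\<lambda>t. f (slice_pt I x t)) has_vector_derivative fy (x, y)) (at y) \<and>
           (1 / 2) *\<^sub>R (fx (x, y) + I * fy (x, y)) = 0" if xy: "(x, y) \<in> T" for x y
  proof (intro conjI)
    have dF: "(F has_field_derivative deriv F (Complex x y)) (at (Complex x y))"
      using TS[OF xy] hol S by (auto intro: holomorphic_derivI)
    have "((\<lambda>t. Complex t y) has_vector_derivative 1) (at x)"
      unfolding Complex_eq by (auto intro!: derivative_eq_intros)
    from field_vector_diff_chain_at[OF this dF]
    have "((\<lambda>t. emb I (F (Complex t y))) has_vector_derivative fx (x, y)) (at x)"
      unfolding fx_def by (auto simp: o_def intro!: bounded_linear.has_vector_derivative[OF bounded_linear_emb])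
    thus "((\<lambda>t. f (slice_pt I t y)) has_vector_derivative fx (x, y)) (at x)"
    proof (rule has_vector_derivative_transform_within_open)
      show "open {t. slice_pt I t y \<in> D}"
      proof -
        have "continuous_on UNIV (\<lambda>t. slice_pt I t y)"
          unfolding slice_pt_def by (intro continuous_intros)
        from open_vimage[OF D this] show ?thesis
          by (simp add: vimage_def)
      qed
      show "x \<in> {t. slice_pt I t y \<in> D}"
        using xy by (simp add: T_def)
      show "emb I (F (Complex t y)) = f (slice_pt I t y)" if "t \<in> {t. slice_pt I t y \<in> D}" for t
        using that eq[OF I, of "Complex t y"] by (simp add: slice_pt_eq_emb)
    qed
    have "((\<lambda>t. Complex x t) has_vector_derivative \<i>) (at y)"
      unfolding Complex_eq by (auto intro!: derivative_eq_intros)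
    from field_vector_diff_chain_at[OF this dF]
    have "((\<lambda>t. emb I (F (Complex x t))) has_vector_derivative fy (x, y)) (at y)"
      unfolding fy_def by (auto simp: o_def intro!: bounded_linear.has_vector_derivative[OF bounded_linear_emb])
    thus "((\<lambda>t. f (slice_pt I x t)) has_vector_derivative fy (x, y)) (at y)"
    proof (rule has_vector_derivative_transform_within_open)
      show "open {t. slice_pt I x t \<in> D}"
      proof -
        have "continuous_on UNIV (\<lambda>t. slice_pt I x t)"
          unfolding slice_pt_def by (intro continuous_intros)
        from open_vimage[OF D this] show ?thesis
          by (simp add: vimage_def)
      qed
      show "y \<in> {t. slice_pt I x t \<in> D}"
        using xy by (simp add: T_def)
      show "emb I (F (Complex x t)) = f (slice_pt I x t)" if "t \<in> {t. slice_pt I x t \<in> D}" for t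
        using that eq[OF I, of "Complex x t"] by (simp add: slice_pt_eq_emb)
    qed
    have "I * emb I (\<i> * w) = - emb I w" for w
      using I by (simp add: emb_mult emb_ii imag_units_def flip: mult.assoc)
    thus "(1 / 2) *\<^sub>R (fx (x, y) + I * fy (x, y)) = 0"
      by (simp add: fx_def fy_def)
  qed
  ultimately show "\<exists>fx fy :: real \<times> real \<Rightarrow> quat.
        continuous_on {(x, y). slice_pt I x y \<in> D} fx \<and>
        continuous_on {(x, y). slice_pt I x y \<in> D} fy \<and>
        (\<forall>x y. slice_pt I x y \<in> D \<longrightarrow>
           ((\<lambda>t. f (slice_pt I t y)) has_vector_derivative fx (x, y)) (at x) \<and>
           ((\<lambda>t. f (slice_pt I x t)) has_vector_derivative fy (x, y)) (at y) \<and>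
           (1 / 2) *\<^sub>R (fx (x, y) + I * fy (x, y)) = 0)"
    unfolding T_def by blast
qed

section \<open>Symmetric slice domains and slice preserving functions\<close>

text \<open>
  The coordinate of \<open>q\<close> in its slice, normalised to the closed upper half plane.
\<close>

definition slice_coord :: "quat \<Rightarrow> complex" where
  "slice_coord q = Complex (qRe q) (norm (q - of_real (qRe q)))"

text \<open>
  A real point lies in every slice; the unit chosen for it is irrelevant.
\<close>

definition slice_unit :: "quat \<Rightarrow> quat" where
  "slice_unit q = (if q = of_real (qRe q) then Quat 0 1 0 0 else sgn (q - of_real (qRe q)))"

text \<open>
  The function that acts as \<open>F\<close> on each slice. For symmetric \<open>F\<close> the normalisation of
    \<open>slice_coord\<close> is immaterial, because reflecting the coordinate amounts to reversing the unit.
\<close>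

definition slice_lift :: "(complex \<Rightarrow> complex) \<Rightarrow> quat \<Rightarrow> quat" where
  "slice_lift F q = emb (slice_unit q) (F (slice_coord q))"

definition axial :: "complex set \<Rightarrow> quat set" where
  "axial S = {q. slice_coord q \<in> S}"

lemma slice_unit_imag_units [simp, intro]: "slice_unit q \<in> imag_units"
proof (cases "q = of_real (qRe q)")
  case False
  hence "norm (sgn (q - of_real (qRe q))) = 1"
    by (simp add: norm_sgn)
  moreover have "qRe (sgn (q - of_real (qRe q))) = 0"
    by (simp add: sgn_quat_def)
  ultimately show ?thesis
    using False by (simp add: slice_unit_def imag_units_iff)
qed (simp add: slice_unit_def imag_units_nonempty)

lemma emb_slice_unit_coord: "emb (slice_unit q) (slice_coord q) = q"
proof (cases "q = of_real (qRe q)")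
  case True
  hence "slice_coord q = of_real (qRe q)"
    by (simp add: slice_coord_def complex_eq_iff)
  thus ?thesis
    using True by simp
next
  case False
  define v where "v = q - of_real (qRe q)"
  have "norm v \<noteq> 0"
    using False by (simp add: v_def)
  have "emb (slice_unit q) (slice_coord q) = of_real (qRe q) + sgn v * of_real (norm v)"
    using False by (simp add: emb_def slice_pt_def slice_coord_def slice_unit_def v_def)
  also have "sgn v * of_real (norm v) = norm v *\<^sub>R sgn v"
    by (simp add: of_real_def)
  also have "\<dots> = v"
    using \<open>norm v \<noteq> 0\<close> by (simp add: sgn_quat_def)
  finally show ?thesis
    by (simp add: v_def)
qed

lemma emb_minus_real:
  assumes "I \<in> imag_units"
  shows "qRe (emb I z) = Re z" "emb I z - of_real (Re z) = Im z *\<^sub>R I"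
  using imag_unitsD(1)[OF assms] by (simp_all add: emb_def slice_pt_def quat_eq_iff)

lemma slice_coord_emb:
  assumes "I \<in> imag_units"
  shows "slice_coord (emb I z) = (if Im z \<ge> 0 then z else cnj z)"
  using imag_unitsD(2)[OF assms] by (simp add: slice_coord_def emb_minus_real[OF assms] complex_eq_iff)

lemma slice_lift_emb:
  assumes I: "I \<in> imag_units" and sym: "conj_symmetric F"
  shows "slice_lift F (emb I z) = emb I (F z)"
proof -
  have F_cnj: "F (cnj z) = cnj (F z)"
    using sym by (simp add: conj_symmetric_def)
  consider "Im z = 0" | "Im z > 0" | "Im z < 0"
    by linarith
  thus ?thesis
  proof cases
    case 1
    hence "cnj z = z"
      by (simp add: complex_eq_iff)
    hence "F z = cnj (F z)"
      using F_cnj by simp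
    hence "F z = of_real (Re (F z))"
      by (simp add: complex_eq_iff)
    thus ?thesis
      using 1 I unfolding slice_lift_def by (metis emb_of_real order_refl slice_coord_emb)
  next
    case 2
    hence "slice_unit (emb I z) = I"
      using imag_unitsD(2)[OF I] emb_minus_real[OF I, of z]
      by (auto simp: slice_unit_def sgn_quat_def)
    thus ?thesis
      using 2 I by (simp add: slice_lift_def slice_coord_emb)
  next
    case 3
    hence "slice_unit (emb I z) = - I"
      using imag_unitsD(2)[OF I] emb_minus_real[OF I, of z]
      by (auto simp: slice_unit_def sgn_quat_def)
    thus ?thesis
      using 3 I by (simp add: slice_lift_def slice_coord_emb emb_uminus F_cnj)
  qed
qed

lemma emb_axial_iff:
  assumes "I \<in> imag_units" "\<And>z. z \<in> S \<Longrightarrow> cnj z \<in> S"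
  shows "emb I z \<in> axial S \<longleftrightarrow> z \<in> S"
  using assms(2)[of z] assms(2)[of "cnj z"] by (auto simp: axial_def slice_coord_emb[OF assms(1)])

lemma open_axial: "open S \<Longrightarrow> open (axial S)"
proof -
  assume S: "open S"
  have re: "bounded_linear qRe"
    using linear_conv_bounded_linear[of qRe] by (auto intro: linearI)
  have "continuous_on UNIV (\<lambda>q. of_real (qRe q) + \<i> * of_real (norm (q - of_real (qRe q))))"
    by (intro continuous_intros linear_continuous_on[OF re])
  hence "continuous_on UNIV slice_coord"
    unfolding slice_coord_def Complex_eq .
  from open_vimage[OF S this] show ?thesis
    by (simp add: axial_def vimage_def)
qed

text \<open>
  The slices of an axially symmetric set all contain its real points; this glues connected slices to
    a connected set.
\<close>

lemma symmetric_slice_domain_axial: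
  assumes S: "open S" "connected S" and sym: "\<And>z. z \<in> S \<Longrightarrow> cnj z \<in> S" and x: "of_real x \<in> S"
  shows "symmetric_slice_domain (axial S)"
proof -
  have emb_iff: "emb I z \<in> axial S \<longleftrightarrow> z \<in> S" if "I \<in> imag_units" for I z
    using that sym by (rule emb_axial_iff)
  have slice: "axial S \<inter> slice I = emb I ` S" if "I \<in> imag_units" for I
    using emb_iff[OF that] by (auto simp: slice_eq_range_emb)
  have conn: "connected (emb I ` S)" for I
    by (intro connected_continuous_image S linear_continuous_on bounded_linear_emb)
  have xS: "of_real x \<in> emb I ` S" for I
    using x by (metis emb_of_real image_eqI)
  have union: "axial S = (\<Union>I\<in>imag_units. emb I ` S)"
  proof safe
    fix q assume "q \<in> axial S"
    hence "q \<in> emb (slice_unit q) ` S"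
      using emb_slice_unit_coord[of q] by (metis axial_def image_eqI mem_Collect_eq)
    thus "q \<in> (\<Union>I\<in>imag_units. emb I ` S)"
      by blast
  qed (use emb_iff in auto)
  have "connected (axial S)"
    unfolding union
  proof (rule connected_Union)
    have "of_real x \<in> (\<Inter>I\<in>imag_units. emb I ` S)"
      using xS by blast
    thus "(\<Inter>I\<in>imag_units. emb I ` S) \<noteq> {}"
      by blast
  qed (use conn in auto)
  moreover have "of_real x \<in> axial S"
    using xS imag_units_nonempty by (auto simp: union)
  moreover have "openin (top_of_set (slice I)) (axial S \<inter> slice I)" for I
    using open_axial[OF S(1)] by (simp add: openin_open_Int Int_commute)
  moreover have "connected (axial S \<inter> slice I)" "axial S \<inter> slice I \<noteq> {}" if "I \<in> imag_units" for I
    using slice[OF that] conn[of I] xS[of I] by auto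
  moreover have "axial S \<inter> \<real> \<noteq> {}"
    using \<open>of_real x \<in> axial S\<close> by (metis IntI Reals_of_real empty_iff)
  ultimately show ?thesis
    unfolding symmetric_slice_domain_def domain_in_def slice_pt_eq_emb
    using open_axial[OF S(1)] emb_iff by auto
qed

lemma symmetric_slice_domain_emb:
  assumes A: "symmetric_slice_domain A"
  obtains S where "open A" "open S" "connected S" "\<And>z. z \<in> S \<Longrightarrow> cnj z \<in> S" "\<exists>x. of_real x \<in> S"
    "\<And>I z. I \<in> imag_units \<Longrightarrow> emb I z \<in> A \<longleftrightarrow> z \<in> S"
proof -
  define J where "J = Quat 0 1 0 0"
  have J: "J \<in> imag_units"
    by (simp add: J_def imag_units_nonempty)
  define S where "S = {z. emb J z \<in> A}"
  have openA: "open A"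
    using A by (simp add: symmetric_slice_domain_def domain_in_def)
  have iff: "emb I z \<in> A \<longleftrightarrow> z \<in> S" if "I \<in> imag_units" for I z
    using A that J unfolding symmetric_slice_domain_def S_def emb_def by blast
  show ?thesis
  proof
    show "open A"
      by fact
    show "open S"
      unfolding S_def by (rule open_emb_preimage) fact
    have "connected (A \<inter> slice J)"
      using A J by (simp add: symmetric_slice_domain_def domain_in_def)
    hence "connected (proj J ` (A \<inter> slice J))"
      by (intro connected_continuous_image linear_continuous_on bounded_linear_proj)
    also have "proj J ` (A \<inter> slice J) = S"
    proof
      show "proj J ` (A \<inter> slice J) \<subseteq> S"
        using J by (auto simp: slice_eq_range_emb S_def)
      show "S \<subseteq> proj J ` (A \<inter> slice J)"
        using J by (auto simp: slice_eq_range_emb S_def intro!: image_eqI[where f = "proj J", OF proj_emb[symmetric]])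
    qed
    finally show "connected S" .
    show "cnj z \<in> S" if "z \<in> S" for z
      using that iff[of "- J" z] J by (simp add: S_def emb_uminus)
    obtain x where "of_real x \<in> A"
      using A by (auto simp: symmetric_slice_domain_def Reals_def)
    thus "\<exists>x. of_real x \<in> S"
      by (auto simp: S_def intro!: exI[of _ x])
  qed (use iff in auto)
qed

lemma symmetric_slice_domain_UNIV: "symmetric_slice_domain UNIV"
  using symmetric_slice_domain_axial[of UNIV 0] by (simp add: axial_def Convex.connected_UNIV)

text \<open>
  On the real axis the values lie in the intersection of two slices and are therefore real, the same
    for each slice. The identity theorem propagates this to the whole of \<open>S\<close>. Comparing \<open>I\<close> with \<open>- I\<close>
    gives the symmetry.
\<close>

lemma slice_preserving_regular_holomorphic:
  assumes A: "symmetric_slice_domain A" and reg: "regular_on A f" and sp: "slice_preserving_on A f"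
    and S: "\<And>I z. I \<in> imag_units \<Longrightarrow> emb I z \<in> A \<longleftrightarrow> z \<in> S"
  obtains F where "F holomorphic_on S" "conj_symmetric F"
    "\<And>I z. I \<in> imag_units \<Longrightarrow> z \<in> S \<Longrightarrow> f (emb I z) = emb I (F z)"
proof -
  define J where "J = Quat 0 1 0 0"
  have J: "J \<in> imag_units"
    by (simp add: J_def imag_units_nonempty)
  obtain S' where S': "open A" "open S'" "connected S'" "\<And>z. z \<in> S' \<Longrightarrow> cnj z \<in> S'"
    "\<exists>x. of_real x \<in> S'" "\<And>I z. I \<in> imag_units \<Longrightarrow> emb I z \<in> A \<longleftrightarrow> z \<in> S'"
    using symmetric_slice_domain_emb[OF A] by blast
  have SS': "S = S'"
    using S S'(6) J by blast
  obtain x where x: "of_real x \<in> S"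
    using S'(5) SS' by blast
  define P where "P = (\<lambda>I z. proj I (f (emb I z)))"
  have P_eq: "f (emb I z) = emb I (P I z)" if "I \<in> imag_units" "z \<in> S" for I z
  proof -
    have "f (emb I z) \<in> slice I"
      using that S sp unfolding slice_preserving_on_def slice_eq_range_emb by blast
    thus ?thesis
      using that by (simp add: P_def emb_proj)
  qed
  have P_hol: "P I holomorphic_on S" if "I \<in> imag_units" for I
    using regular_on_proj_holomorphic[OF reg S'(1) that] S[OF that] by (simp add: P_def)
  have P_real: "P I (of_real t) = of_real (qRe (f (of_real t)))" if I: "I \<in> imag_units" and t: "of_real t \<in> S" for I t
  proof -
    \<comment> \<open>Two units that are linearly independent suffice: their slices meet in the real axis.\<close>
    define K where "K = Quat 0 0 1 0"
    have K: "K \<in> imag_units"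
      by (simp add: K_def imag_units_iff norm_quat_def)
    have f_emb: "f (of_real t) = emb L (P L (of_real t))" if "L \<in> imag_units" for L
      using P_eq[OF that t] by simp
    have "qIm2 (f (of_real t)) = 0" "qIm3 (f (of_real t)) = 0"
      using f_emb[OF J] by (simp_all add: emb_def slice_pt_def J_def)
    moreover have "qIm1 (f (of_real t)) = 0"
      using f_emb[OF K] by (simp add: emb_def slice_pt_def K_def)
    ultimately have "f (of_real t) = emb I (of_real (qRe (f (of_real t))))"
      by (simp add: quat_eq_iff)
    thus ?thesis
      using f_emb[OF I] I by (metis emb_inj)
  qed
  have P_indep: "P I z = P J z" if I: "I \<in> imag_units" and z: "z \<in> S" for I z
  proof -
    have "P I z - P J z = 0"
    proof (rule analytic_continuation[where f = "\<lambda>z. P I z - P J z" and U = "S \<inter> \<real>" and \<xi> = "of_real x"])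
      show "(\<lambda>z. P I z - P J z) holomorphic_on S"
        by (intro holomorphic_intros P_hol I J)
      show "open S" "connected S"
        using S' SS' by auto
      show "of_real x \<in> S" "z \<in> S"
        by fact+
      show "S \<inter> \<real> \<subseteq> S"
        by simp
      show "P I w - P J w = 0" if "w \<in> S \<inter> \<real>" for w
        using that P_real[OF I] P_real[OF J] by (auto simp: Reals_def)
      show "of_real x islimpt S \<inter> (\<real> :: complex set)"
        unfolding islimpt_approachable
      proof safe
        fix e :: real assume "e > 0"
        obtain d where d: "d > 0" "ball (of_real x) d \<subseteq> S"
          using S'(2) SS' x openE by blast
        define t where "t = min d e / 2"
        have t: "t > 0" "t < d" "t < e"
          using d(1) \<open>e > 0\<close> by (auto simp: t_def)
        have dist: "dist (of_real (x + t)) (of_real x :: complex) = t"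
          using t(1) by (simp add: dist_norm)
        hence "of_real (x + t) \<in> ball (of_real x :: complex) d"
          using t(2) by (simp add: dist_commute)
        moreover have "of_real (x + t) \<noteq> (of_real x :: complex)"
          using t(1) by simp
        ultimately show "\<exists>x'\<in>S \<inter> \<real>. x' \<noteq> of_real x \<and> dist x' (of_real x) < e"
          using d(2) dist t(3) by (intro bexI[of _ "of_real (x + t)"]) auto
      qed
    qed
    thus ?thesis
      by simp
  qed
  define F where "F = (\<lambda>z. if z \<in> S then P J z else 0)"
  show ?thesis
  proof
    show "F holomorphic_on S"
      using P_hol[OF J] by (rule holomorphic_transform) (simp add: F_def)
    show "f (emb I z) = emb I (F z)" if "I \<in> imag_units" "z \<in> S" for I z
      using P_eq[OF that] P_indep[OF that] that by (simp add: F_def)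
    have "P J (cnj z) = cnj (P J z)" if "z \<in> S" for z
    proof -
      have "P J (cnj z) = P (- J) (cnj z)"
        using P_indep[of "- J" "cnj z"] J S'(4) SS' that by simp
      also have "\<dots> = cnj (P J z)"
        using J by (simp add: P_def proj_uminus emb_uminus)
      finally show ?thesis .
    qed
    moreover have "cnj z \<in> S \<longleftrightarrow> z \<in> S" for z
      using S'(4)[of z] S'(4)[of "cnj z"] SS' by auto
    ultimately show "conj_symmetric F"
      by (auto simp: conj_symmetric_def F_def)
  qed
qed

section \<open>Semiregular functions are symmetric meromorphic functions\<close>

lemma punctured_disc_emb_iff:
  assumes "I \<in> imag_units"
  shows "emb I w \<in> punctured_disc I (emb I z) R \<longleftrightarrow> w \<in> ball z R - {z}"
proof -
  have "norm (emb I w - emb I z) = dist z w"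
    using norm_emb[OF assms, of "w - z"] by (simp add: emb_diff dist_norm norm_minus_commute)
  thus ?thesis
    by (auto simp: punctured_disc_def slice_eq_range_emb)
qed

text \<open>
  The coefficients of the expansion are arbitrary quaternions, but applying \<open>proj I\<close> gives a
    complex Laurent series for \<open>F\<close>. Its absolute convergence at one radius \<open>r\<close> bounds \<open>F\<close> times a power of
    \<open>w - z\<close> on the punctured disc of radius \<open>r\<close>, and Riemann's theorem on removable singularities applies.
\<close>

lemma principal_part_imp_not_essential:
  assumes I: "I \<in> imag_units" and R: "R > 0" and hol: "F holomorphic_on ball z R - {z}"
    and F: "\<And>w. w \<in> ball z R - {z} \<Longrightarrow> F w = proj I (f (emb I w))"
    and laurent: "Defs.laurent_expansion f I (emb I z) R a" and l: "\<And>n. n > l \<Longrightarrow> a (- n) = 0"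
  shows "not_essential F z"
proof -
  define c where "c = (\<lambda>n. proj I (a n))"
  have c_sum: "((\<lambda>n. (w - z) powi n * c n) has_sum F w) UNIV" if w: "w \<in> ball z R - {z}" for w
  proof -
    have "((\<lambda>n. (emb I w - emb I z) powi n * a n) has_sum f (emb I w)) UNIV"
      using laurent w punctured_disc_emb_iff[OF I] unfolding Defs.laurent_expansion_def by blast
    hence "((\<lambda>n. proj I ((emb I w - emb I z) powi n * a n)) has_sum proj I (f (emb I w))) UNIV"
      by (rule has_sum_bounded_linear[OF bounded_linear_proj])
    thus ?thesis
      using I w by (simp add: c_def F proj_mult flip: emb_diff emb_power_int)
  qed
  \<comment> \<open>From here on the principal part has at most \<open>N\<close> terms.\<close>
  define N where "N = nat (max l 0)"
  have c0: "c n = 0" if "n < - int N" for n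
    using l[of "- n"] that linear_0[OF linear_proj] by (simp add: c_def N_def)
  define r where "r = R / 2"
  have r: "r > 0" "r < R"
    using R by (simp_all add: r_def)
  have "z + of_real r \<in> ball z R - {z}"
    using r by (auto simp: dist_norm)
  hence "(\<lambda>n. of_real r powi n * c n) summable_on UNIV"
    using has_sum_imp_summable[OF c_sum[of "z + of_real r"]] by simp
  hence "(\<lambda>n. norm (of_real r powi n * c n)) summable_on UNIV"
    by (simp only: summable_on_iff_abs_summable_on_complex)
  hence sum_r: "(\<lambda>n. r powi n * norm (c n)) summable_on UNIV"
    using r by (simp add: norm_mult norm_power_int)
  define C where "C = infsum (\<lambda>n. r powi n * norm (c n)) UNIV"
  have bound: "norm ((w - z) ^ N * F w) \<le> r ^ N * C" if w: "w \<in> ball z r - {z}" for w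
  proof -
    define s where "s = norm (w - z)"
    have s: "0 < s" "s \<le> r"
      using w by (auto simp: s_def dist_norm norm_minus_commute)
    have wR: "w \<in> ball z R - {z}"
      using w r by auto
    \<comment> \<open>Terms with \<open>n < - N\<close> vanish, and for the others the exponent \<open>N + n\<close> is nonnegative, so
      that each term is increasing in the radius.\<close>
    have le: "s ^ N * (s powi n * norm (c n)) \<le> r ^ N * (r powi n * norm (c n))" for n
    proof (cases "n < - int N")
      case False
      define m where "m = nat (n + int N)"
      have m: "int N + n = int m"
        using False by (simp add: m_def)
      have e: "x ^ N * x powi n = x ^ m" if "x > 0" for x :: real
        using that m power_int_add[of x "int N" n] by simp
      have "s ^ N * s powi n \<le> r ^ N * r powi n"
        using s r by (simp add: e power_mono)
      thus ?thesis
        by (simp add: mult_right_mono flip: mult.assoc)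
    qed (simp add: c0)
    have sum_s: "(\<lambda>n. norm ((w - z) powi n * c n)) summable_on UNIV"
      using has_sum_imp_summable[OF c_sum[OF wR]] by (simp only: summable_on_iff_abs_summable_on_complex)
    hence sum_s': "(\<lambda>n. s powi n * norm (c n)) summable_on UNIV"
      by (simp add: s_def norm_mult norm_power_int)
    have "norm ((w - z) ^ N * F w) = s ^ N * norm (infsum (\<lambda>n. (w - z) powi n * c n) UNIV)"
      using infsumI[OF c_sum[OF wR]] by (simp add: norm_mult norm_power s_def)
    also have "\<dots> \<le> s ^ N * infsum (\<lambda>n. norm ((w - z) powi n * c n)) UNIV"
      using sum_s s by (intro mult_left_mono norm_infsum_bound) auto
    also have "\<dots> = infsum (\<lambda>n. s ^ N * (s powi n * norm (c n))) UNIV"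
      by (simp add: infsum_cmult_right' norm_mult norm_power_int s_def)
    also have "\<dots> \<le> infsum (\<lambda>n. r ^ N * (r powi n * norm (c n))) UNIV"
      by (intro infsum_mono summable_on_cmult_right sum_r sum_s' le)
    also have "\<dots> = r ^ N * C"
      by (simp add: infsum_cmult_right' C_def)
    finally show ?thesis .
  qed
  have "\<forall>\<^sub>F w in at z. norm ((w - z) ^ N * F w) \<le> r ^ N * C"
    by (rule eventually_mono[OF eventually_at_in_open[of "ball z r" z]]) (use r(1) bound in auto)
  moreover have "(\<lambda>w. (w - z) ^ N * F w) holomorphic_on ball z R - {z}"
    by (intro holomorphic_intros hol)
  moreover have "z \<in> interior (ball z R)"
    using R by (simp add: interior_open)
  ultimately have "\<exists>g. g holomorphic_on ball z R \<and> (\<forall>w\<in>ball z R - {z}. g w = (w - z) ^ N * F w)"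
    using holomorphic_on_extend_bounded[of "\<lambda>w. (w - z) ^ N * F w" "ball z R" z] by blast
  then obtain g where g: "g holomorphic_on ball z R" "\<forall>w\<in>ball z R - {z}. g w = (w - z) ^ N * F w"
    by blast
  have "(\<lambda>w. g w / (w - z) ^ N) meromorphic_on {z}"
    using g(1) R by (intro meromorphic_intros analytic_on_imp_meromorphic_on)
      (auto simp: analytic_at intro!: exI[of _ "ball z R"])
  also have "?this \<longleftrightarrow> F meromorphic_on {z}"
  proof (rule meromorphic_on_cong)
    fix w assume "w \<in> {z}"
    have "\<forall>\<^sub>F u in at z. u \<in> ball z R - {z}"
      using R by (intro eventually_at_in_open) auto
    thus "\<forall>\<^sub>F u in at w. g u / (u - z) ^ N = F u"
      using \<open>w \<in> {z}\<close> by (simp add: eventually_mono g(2))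
  qed simp
  finally show ?thesis
    by (simp add: meromorphic_at_iff)
qed

text \<open>
  The regular extension is continuous on the slice, which gives the limit.
\<close>

lemma removable_imp_limit:
  assumes I: "I \<in> imag_units" and F: "\<And>w. w \<in> ball z R - {z} \<Longrightarrow> emb I w \<in> A \<and> F w = proj I (f (emb I w))"
    and R: "R > 0" and rem: "removable_singularity A f I (emb I z)"
  shows "\<exists>c. F \<midarrow>z\<rightarrow> c"
proof -
  obtain U g where U: "open U" "emb I z \<in> U" "regular_on U g" "\<forall>q\<in>U \<inter> A. g q = f q"
    using rem unfolding removable_singularity_def by blast
  have cont: "isCont (\<lambda>w. g (emb I w)) z"
    using regular_on_isCont[OF U(3,1) I U(2)] .
  have "(\<lambda>w. proj I (g (emb I w))) \<midarrow>z\<rightarrow> proj I (g (emb I z))"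
    using cont unfolding isCont_def by (rule bounded_linear.tendsto[OF bounded_linear_proj])
  moreover have ev: "\<forall>\<^sub>F w in at z. proj I (g (emb I w)) = F w"
  proof -
    have "\<forall>\<^sub>F w in at z. w \<in> ball z R - {z}"
      using R by (intro eventually_at_in_open) auto
    moreover have "\<forall>\<^sub>F w in at z. w \<in> {w. emb I w \<in> U}"
      using U(1,2) by (intro eventually_at_in_open' open_emb_preimage) auto
    ultimately show ?thesis
    proof eventually_elim
      case (elim w)
      hence "emb I w \<in> A" "F w = proj I (f (emb I w))" "g (emb I w) = f (emb I w)"
        using F[of w] U(4) by blast+
      thus ?case
        by simp
    qed
  qed
  ultimately show ?thesis
    using tendsto_cong[OF ev] by metis
qed

text \<open>
  Besides the meromorphic function, this records the set \<open>S\<close> of its points inside the domain \<open>A\<close> of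
    regularity: singularities are isolated, so \<open>S\<close> misses only a set without accumulation points.
\<close>

lemma semiregular_imp_meromorphic:
  assumes "semiregular_with UNIV A f"
  obtains F S where "sym_meromorphic F" "\<forall>\<^sub>\<approx>z. z \<in> S"
    "\<And>I z. I \<in> imag_units \<Longrightarrow> emb I z \<in> A \<longleftrightarrow> z \<in> S"
    "\<And>I z. I \<in> imag_units \<Longrightarrow> z \<in> S \<Longrightarrow> f (emb I z) = emb I (F z)"
proof -
  have A: "symmetric_slice_domain A" "regular_on A f" "slice_preserving_on A f"
    and sing: "\<And>p. p \<notin> A \<Longrightarrow> \<exists>I\<in>imag_units. pole_at A f I p \<or> removable_singularity A f I p"
    using assms by (auto simp: semiregular_with_def)
  obtain S where S: "open A" "open S" "\<And>I z. I \<in> imag_units \<Longrightarrow> emb I z \<in> A \<longleftrightarrow> z \<in> S"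
    using symmetric_slice_domain_emb[OF A(1)] by metis
  obtain F where F: "F holomorphic_on S" "conj_symmetric F"
    "\<And>I z. I \<in> imag_units \<Longrightarrow> z \<in> S \<Longrightarrow> f (emb I z) = emb I (F z)"
    using slice_preserving_regular_holomorphic[OF A S(3)] by metis
  have F_proj: "F w = proj I (f (emb I w))" if "I \<in> imag_units" "w \<in> S" for I w
    using F(3)[OF that] that by simp
  have at_sing: "(\<forall>\<^sub>F w in at z. w \<in> S) \<and> F meromorphic_on {z}" for z
  proof (cases "z \<in> S")
    case True
    have "\<forall>\<^sub>F w in at z. w \<in> S"
      using S(2) True by (rule eventually_at_in_open')
    moreover have "F analytic_on {z}"
      using F(1) S(2) True by (auto simp: analytic_at)
    ultimately show ?thesis
      by (auto intro: analytic_on_imp_meromorphic_on)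
  next
    case False
    define p where "p = emb (Quat 0 1 0 0) z"
    have "p \<notin> A"
      using False S(3)[OF imag_units_nonempty] by (simp add: p_def)
    then obtain I' where I': "I' \<in> imag_units" "pole_at A f I' p \<or> removable_singularity A f I' p"
      using sing by blast
    obtain I where I: "I \<in> imag_units" "emb I z = p" "pole_at A f I p \<or> removable_singularity A f I p"
    proof -
      have "p \<in> slice I'"
        using I' by (auto simp: pole_at_def removable_singularity_def singularity_def)
      then obtain w where w: "p = emb I' w"
        by (auto simp: slice_eq_range_emb)
      have "slice_coord p = (if Im z \<ge> 0 then z else cnj z)"
        unfolding p_def by (rule slice_coord_emb[OF imag_units_nonempty])
      moreover have "slice_coord p = (if Im w \<ge> 0 then w else cnj w)"
        unfolding w by (rule slice_coord_emb[OF I'(1)])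
      ultimately have "w = z \<or> w = cnj z"
        by (auto split: if_splits simp: complex_eq_iff)
      thus ?thesis
      proof
        assume "w = z"
        thus ?thesis
          using that[of I'] I' w by simp
      next
        assume wz: "w = cnj z"
        \<comment> \<open>The units \<open>I'\<close> and \<open>- I'\<close> have the same slice, and the notions of singularity only depend
          on the slice, so the unit can be chosen to fit \<open>z\<close>.\<close>
        have sl: "slice (- I') = slice I'"
        proof -
          have "range (emb (- I')) = emb I' ` range cnj"
            by (simp add: image_image emb_uminus)
          thus ?thesis
            by (simp add: slice_eq_range_emb surjI[of cnj cnj])
        qed
        have pd: "punctured_disc (- I') = punctured_disc I'"
          by (simp add: punctured_disc_def fun_eq_iff sl)
        have si: "singularity A (- I') = singularity A I'"
          by (simp add: singularity_def fun_eq_iff sl pd)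
        have "pole_at A f (- I') p = pole_at A f I' p"
          "removable_singularity A f (- I') p = removable_singularity A f I' p"
          by (simp_all add: pole_at_def removable_singularity_def Defs.laurent_expansion_def pd si)
        thus ?thesis
          using that[of "- I'"] I' w wz by (simp add: emb_uminus)
      qed
    qed
    have "singularity A I p"
      using I(3) by (auto simp: pole_at_def removable_singularity_def)
    then obtain R where R: "R > 0" "punctured_disc I p R \<subseteq> A"
      by (auto simp: singularity_def)
    have disc_S: "ball z R' - {z} \<subseteq> S" if "punctured_disc I p R' \<subseteq> A" for R'
      using punctured_disc_emb_iff[OF I(1), of _ z R'] S(3)[OF I(1)] that I(2) by blast
    have ev: "\<forall>\<^sub>F w in at z. w \<in> ball z R - {z}"
      using R(1) by (intro eventually_at_in_open) auto
    have "isolated_singularity_at F z"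
      using disc_S[OF R(2)] R(1) F(1) by (intro isolated_singularity_at_holomorphic[of F "ball z R"])
        (auto intro: holomorphic_on_subset)
    moreover have "not_essential F z"
      using I(3)
    proof
      assume "pole_at A f I p"
      then obtain R' a l where R': "R' > 0" "punctured_disc I p R' \<subseteq> A" "Defs.laurent_expansion f I p R' a"
        "\<forall>n>l. a (- n) = 0"
        by (auto simp: pole_at_def)
      show ?thesis
      proof (rule principal_part_imp_not_essential[OF I(1) R'(1)])
        show "F holomorphic_on ball z R' - {z}"
          using F(1) disc_S[OF R'(2)] by (rule holomorphic_on_subset)
        show "F w = proj I (f (emb I w))" if "w \<in> ball z R' - {z}" for w
          using that disc_S[OF R'(2)] F_proj[OF I(1)] by blast
        show "Defs.laurent_expansion f I (emb I z) R' a"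
          using R'(3) I(2) by simp
      qed (use R'(4) in blast)
    next
      assume rem: "removable_singularity A f I p"
      have "\<exists>c. F \<midarrow>z\<rightarrow> c"
      proof (rule removable_imp_limit[OF I(1) _ R(1)])
        show "emb I w \<in> A \<and> F w = proj I (f (emb I w))" if "w \<in> ball z R - {z}" for w
          using that disc_S[OF R(2)] F_proj[OF I(1)] S(3)[OF I(1)] by blast
        show "removable_singularity A f I (emb I z)"
          using rem I(2) by simp
      qed
      thus ?thesis
        by (auto simp: not_essential_def)
    qed
    moreover have "\<forall>\<^sub>F w in at z. w \<in> S"
      using ev by (rule eventually_mono) (use disc_S[OF R(2)] in blast)
    ultimately show ?thesis
      by (simp add: meromorphic_at_iff)
  qed
  show ?thesis
  proof
    show "sym_meromorphic F"
      using at_sing F(2) unfolding sym_meromorphic_def by (subst meromorphic_on_meromorphic_at) auto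
    show "\<forall>\<^sub>\<approx>z. z \<in> S"
      using at_sing by (auto simp: eventually_cosparse_open_eq)
  qed (use S(3) F(3) in auto)
qed

text \<open>
  The dictionary between slice preserving functions on the quaternions and functions on the plane. It
    ignores isolated points, so it depends only on the class of \<open>f\<close>.
\<close>

definition represents :: "(quat \<Rightarrow> quat) \<Rightarrow> (complex \<Rightarrow> complex) \<Rightarrow> bool" where
  "represents f F \<longleftrightarrow>
     sym_meromorphic F \<and> (\<forall>\<^sub>\<approx>z. \<forall>I\<in>imag_units. f (emb I z) = emb I (F z))"

text \<open>
  Limits at conjugate points are conjugate to each other, so filling in removable singularities does not
    destroy the symmetry.
\<close>

lemma conj_symmetric_remove_sings:
  assumes "conj_symmetric F"
  shows "conj_symmetric (remove_sings F)"
proof -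
  have F: "F (cnj z) = cnj (F z)" for z
    using assms by (simp add: conj_symmetric_def)
  have lim: "F \<midarrow>cnj z\<rightarrow> cnj c" if "F \<midarrow>z\<rightarrow> c" for z c
  proof -
    have "filterlim cnj (at z) (at (cnj z))"
      using filterlim_cnj_at[of "cnj z"] by simp
    hence "(\<lambda>w. F (cnj w)) \<midarrow>cnj z\<rightarrow> c"
      using that by (rule filterlim_compose[rotated])
    hence "(\<lambda>w. cnj (F (cnj w))) \<midarrow>cnj z\<rightarrow> cnj c"
      by (rule tendsto_cnj)
    thus ?thesis
      by (simp add: F)
  qed
  have "remove_sings F (cnj z) = cnj (remove_sings F z)" for z
  proof (cases "\<exists>c. F \<midarrow>z\<rightarrow> c")
    case True
    then obtain c where "F \<midarrow>z\<rightarrow> c"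
      by blast
    thus ?thesis
      using lim remove_sings_eqI by metis
  next
    case False
    moreover from False have "\<nexists>c. F \<midarrow>cnj z\<rightarrow> c"
      using lim[where z = "cnj z"] by auto
    ultimately show ?thesis
      by (simp add: remove_sings_def)
  qed
  thus ?thesis
    by (simp add: conj_symmetric_def)
qed

lemma conj_symmetric_analytic_at_cnj:
  assumes "conj_symmetric F" "F analytic_on {z}"
  shows "F analytic_on {cnj z}"
proof -
  have eq: "cnj \<circ> F \<circ> cnj = F"
    using assms(1) by (simp add: conj_symmetric_def fun_eq_iff)
  obtain s where s: "open s" "z \<in> s" "F holomorphic_on s"
    using assms(2) by (auto simp: analytic_at)
  have "cnj ` s = cnj -` s"
    by (auto simp: image_iff) (metis complex_cnj_cnj)
  hence op: "open (cnj ` s)"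
    using s(1) by (simp add: open_vimage continuous_on_cnj)
  have "cnj ` cnj ` s = s"
    by (simp add: image_image)
  hence "cnj \<circ> F \<circ> cnj holomorphic_on (cnj ` s)"
    using s(3) op by (intro holomorphic_on_compose_cnj_cnj) auto
  thus ?thesis
    using op s(2) unfolding eq by (auto simp: analytic_at)
qed

text \<open>
  Near a pole \<open>G\<close> is a holomorphic function divided by a power of \<open>w - z\<close>. The Taylor series of the
    former, shifted and carried into the slice by \<open>emb I\<close>, is the expansion sought.
\<close>

lemma pole_imp_laurent_expansion:
  assumes I: "I \<in> imag_units" and R: "R > 0" and hol: "G holomorphic_on ball z R - {z}"
    and pole: "is_pole G z" and f: "\<And>w. w \<in> ball z R - {z} \<Longrightarrow> f (emb I w) = emb I (G w)"
  obtains r a l where "0 < r" "r \<le> R" "Defs.laurent_expansion f I (emb I z) r a"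
    "l \<ge> 0" "\<And>n. n > l \<Longrightarrow> a (- n) = 0"
proof -
  define N where "N = nat (- zorder G z)"
  obtain r g where r: "r > 0" "cball z r \<subseteq> ball z R" and g: "g holomorphic_on cball z r"
    "\<And>w. w \<in> cball z r - {z} \<Longrightarrow> G w = g w / (w - z) ^ N"
    using zorder_exist_pole[OF hol open_ball _ pole] R by (auto simp: N_def)
  define b where "b = (\<lambda>k. (deriv ^^ k) g z / fact k)"
  have g_sums: "(\<lambda>k. b k * (w - z) ^ k) sums g w" if "w \<in> ball z r" for w
    unfolding b_def using holomorphic_power_series[OF holomorphic_on_subset[OF g(1) ball_subset_cball] that] .
  define a where "a = (\<lambda>n. if n \<ge> - int N then emb I (b (nat (n + int N))) else 0)"
  have "((\<lambda>n. (emb I w - emb I z) powi n * a n) has_sum f (emb I w)) UNIV" if w: "w \<in> ball z r - {z}" for w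
  proof -
    obtain t where t: "norm (w - z) < t" "t < r"
      using w dense[of "norm (w - z)" r] by (auto simp: dist_norm norm_minus_commute)
    have "t > 0"
      using t(1) norm_ge_zero[of "w - z"] by linarith
    have "summable (\<lambda>k. b k * of_real t ^ k)"
      using g_sums[of "z + of_real t"] t \<open>t > 0\<close> by (auto simp: dist_norm sums_iff)
    hence "summable (\<lambda>k. norm (b k * (w - z) ^ k))"
      by (rule powser_insidea) (use t \<open>t > 0\<close> in auto)
    moreover have "(\<lambda>k. b k * (w - z) ^ k) sums g w"
      using w by (intro g_sums) auto
    ultimately have "((\<lambda>k. b k * (w - z) ^ k) has_sum g w) UNIV"
      by (rule norm_summable_imp_has_sum)
    hence "((\<lambda>k. b k * (w - z) ^ k * inverse ((w - z) ^ N)) has_sum g w * inverse ((w - z) ^ N)) UNIV"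
      by (rule has_sum_cmult_left)
    moreover have "b k * (w - z) ^ k * inverse ((w - z) ^ N) = (w - z) powi (int k - int N) * b k" for k
      using w by (simp add: power_int_diff divide_inverse)
    moreover have "g w * inverse ((w - z) ^ N) = G w"
      using w g(2)[of w] by (simp add: divide_inverse)
    ultimately have "((\<lambda>k. (w - z) powi (int k - int N) * b k) has_sum G w) UNIV"
      by simp
    hence "((\<lambda>k. emb I ((w - z) powi (int k - int N) * b k)) has_sum emb I (G w)) UNIV"
      by (rule has_sum_bounded_linear[OF bounded_linear_emb])
    moreover have "emb I (G w) = f (emb I w)"
      using f[of w] w r(2) by (auto simp: subset_iff)
    ultimately have "((\<lambda>k. (emb I w - emb I z) powi (int k - int N) * emb I (b k)) has_sum f (emb I w)) UNIV"
      by (simp only: emb_mult[OF I] emb_power_int[OF I] emb_diff)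
    also have "?this \<longleftrightarrow> (((\<lambda>n. (emb I w - emb I z) powi n * a n) \<circ> (\<lambda>k. int k - int N)) has_sum f (emb I w)) UNIV"
      by (simp add: o_def a_def)
    also have "\<dots> \<longleftrightarrow> ((\<lambda>n. (emb I w - emb I z) powi n * a n) has_sum f (emb I w)) (range (\<lambda>k. int k - int N))"
      by (rule has_sum_reindex[symmetric]) (auto simp: inj_on_def)
    also have "\<dots> \<longleftrightarrow> ((\<lambda>n. (emb I w - emb I z) powi n * a n) has_sum f (emb I w)) UNIV"
    proof (rule has_sum_cong_neutral)
      fix n assume n: "n \<in> UNIV - range (\<lambda>k. int k - int N)"
      have "n < - int N"
      proof (rule ccontr)
        assume "\<not> n < - int N"
        hence "n = int (nat (n + int N)) - int N"
          by simp
        thus False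
          using n by blast
      qed
      thus "(emb I w - emb I z) powi n * a n = 0"
        by (simp add: a_def)
    qed auto
    finally show ?thesis .
  qed
  hence "Defs.laurent_expansion f I (emb I z) r a"
    unfolding Defs.laurent_expansion_def using punctured_disc_emb_iff[OF I]
    by (auto simp: punctured_disc_def slice_eq_range_emb)
  moreover have "a (- n) = 0" if "n > int N" for n
    using that by (simp add: a_def)
  moreover have "r \<le> R"
    using r by (simp add: cball_subset_ball_iff)
  ultimately show ?thesis
    using that[of r a "int N"] r(1) by simp
qed

text \<open>
  As domain serves the set of points where the meromorphic function is analytic and agrees with \<open>f\<close>.
    A point outside it is a pole of the meromorphic function, hence of \<open>f\<close>, or a point where only the
    value of \<open>f\<close> is wrong, hence a removable singularity.
\<close>

lemma meromorphic_imp_semiregular: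
  assumes "represents f F"
  obtains A where "semiregular_with UNIV A f"
    "\<And>I z. I \<in> imag_units \<Longrightarrow> emb I z \<in> A \<Longrightarrow> f (emb I z) = emb I (remove_sings F z)"
proof -
  define G where "G = remove_sings F"
  have mero: "F meromorphic_on UNIV" and F_sym: "conj_symmetric F"
    and f_F: "\<forall>\<^sub>\<approx>z. \<forall>I\<in>imag_units. f (emb I z) = emb I (F z)"
    using assms by (auto simp: represents_def sym_meromorphic_def)
  have nice: "G nicely_meromorphic_on UNIV"
    unfolding G_def by (rule remove_sings_nicely_meromorphic[OF mero])
  have G_mero: "G meromorphic_on UNIV"
    using nice by (simp add: nicely_meromorphic_on_def)
  have G_sym: "conj_symmetric G"
    unfolding G_def by (rule conj_symmetric_remove_sings[OF F_sym])
  have G_cnj: "G (cnj z) = cnj (G z)" for z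
    using G_sym by (simp add: conj_symmetric_def)
  have G_an_cnj: "G analytic_on {cnj z}" if "G analytic_on {z}" for z
    using conj_symmetric_analytic_at_cnj[OF G_sym that] .
  define S where "S = {z. G analytic_on {z} \<and> (\<forall>I\<in>imag_units. f (emb I z) = emb I (G z))}"
  have S_co: "\<forall>\<^sub>\<approx>z. z \<in> S"
    using meromorphic_on_imp_analytic_cosparse[OF G_mero] f_F eventually_remove_sings_eq[OF mero]
    by eventually_elim (auto simp: S_def G_def)
  have S_ev: "\<forall>\<^sub>F w in at z. w \<in> S" for z
    using S_co by (rule eventually_at_if_cosparse)
  have sparse: "(- S) sparse_in UNIV"
    using S_co by (simp add: eventually_cosparse Compl_eq)
  have S_open: "open S"
    using sparse_in_UNIV_imp_closed[OF sparse] by (simp add: closed_def)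
  have S_conn: "connected S"
    using sparse_imp_connected[OF _ Convex.connected_UNIV open_UNIV sparse]
    by (simp add: Compl_eq_Diff_UNIV[symmetric])
  have S_cnj: "cnj z \<in> S" if z: "z \<in> S" for z
  proof -
    have "f (emb I (cnj z)) = emb I (G (cnj z))" if "I \<in> imag_units" for I
    proof -
      have "f (emb (- I) z) = emb (- I) (G z)"
        using z that by (simp add: S_def)
      thus ?thesis
        by (simp add: emb_uminus G_cnj)
    qed
    thus ?thesis
      using z G_an_cnj by (simp add: S_def)
  qed
  obtain x where x: "of_real x \<in> S"
  proof -
    have "countable (- S)"
      using sparse_imp_countable[OF open_UNIV sparse] by simp
    moreover have "uncountable (range complex_of_real)"
      using uncountable_UNIV_real countable_image_inj_eq[of complex_of_real UNIV] by (simp add: inj_of_real)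
    ultimately have "\<not> range complex_of_real \<subseteq> - S"
      using countable_subset by metis
    thus ?thesis
      using that by auto
  qed
  define A where "A = axial S"
  have A: "symmetric_slice_domain A"
    unfolding A_def using S_open S_conn S_cnj x by (rule symmetric_slice_domain_axial)
  have A_iff: "emb I z \<in> A \<longleftrightarrow> z \<in> S" if "I \<in> imag_units" for I z
    unfolding A_def using that S_cnj by (rule emb_axial_iff)
  have f_G: "f (emb I z) = emb I (G z)" if "I \<in> imag_units" "z \<in> S" for I z
    using that by (simp add: S_def)
  have G_hol: "G holomorphic_on S"
    by (rule analytic_imp_holomorphic, subst analytic_on_analytic_at) (simp add: S_def)
  have sing: "pole_at A f I (emb I z) \<or> removable_singularity A f I (emb I z)"
    if I: "I \<in> imag_units" and z: "z \<notin> S" for I z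
  proof -
    obtain R where R: "R > 0" "ball z R - {z} \<subseteq> S"
    proof -
      obtain d where d: "d > 0" "\<And>w. w \<noteq> z \<Longrightarrow> dist w z < d \<Longrightarrow> w \<in> S"
        using S_ev[of z] by (auto simp: eventually_at)
      have "ball z d - {z} \<subseteq> S"
        using d(2) by (simp add: subset_eq dist_commute)
      thus ?thesis
        using that d(1) by blast
    qed
    have disc: "punctured_disc I (emb I z) r \<subseteq> A" if "r \<le> R" for r
    proof
      fix q assume q: "q \<in> punctured_disc I (emb I z) r"
      then obtain w where w: "q = emb I w"
        by (auto simp: punctured_disc_def slice_eq_range_emb)
      hence "w \<in> ball z r - {z}"
        using q punctured_disc_emb_iff[OF I] by blast
      thus "q \<in> A"
        using R(2) that A_iff[OF I] w by auto
    qed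
    have singularity: "singularity A I (emb I z)"
      unfolding singularity_def slice_eq_range_emb using R(1) disc[OF order_refl] by blast
    show ?thesis
    proof (cases "is_pole G z")
      case False
      \<comment> \<open>The extension is the lift of \<open>G\<close> itself, which is regular on the axially symmetric open
        set of all points where \<open>G\<close> is analytic.\<close>
      define T where "T = {w. G analytic_on {w}}"
      have T_cnj: "cnj w \<in> T" if "w \<in> T" for w
        using that G_an_cnj by (simp add: T_def)
      have T_open: "open T"
      proof -
        have "{w. \<not> G analytic_on {w}} sparse_in UNIV"
          by (rule meromorphic_on_imp_sparse_singularities[OF G_mero])
        hence "closed (- T)"
          using sparse_in_UNIV_imp_closed by (auto simp: T_def Compl_eq)
        thus ?thesis
          by (simp add: closed_def)
      qed
      have T_iff: "emb J w \<in> axial T \<longleftrightarrow> w \<in> T" if "J \<in> imag_units" for J w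
        using that T_cnj by (rule emb_axial_iff)
      have "regular_on (axial T) (slice_lift G)"
      proof (rule regular_onI_holomorphic[OF open_axial[OF T_open] T_open])
        show "G holomorphic_on T"
          by (rule analytic_imp_holomorphic, subst analytic_on_analytic_at) (simp add: T_def)
      qed (use T_iff slice_lift_emb[OF _ G_sym] in auto)
      moreover have "emb I z \<in> axial T"
        using nicely_meromorphic_on_imp_analytic_at[OF nice _ False] T_iff[OF I] by (simp add: T_def)
      moreover have "slice_lift G q = f q" if "q \<in> A" for q
      proof -
        have q: "emb (slice_unit q) (slice_coord q) = q"
          by (rule emb_slice_unit_coord)
        hence "slice_coord q \<in> S"
          using that A_iff[of "slice_unit q" "slice_coord q"] by simp
        thus ?thesis
          using f_G[of "slice_unit q" "slice_coord q"] q by (simp add: slice_lift_def)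
      qed
      ultimately have "removable_singularity A f I (emb I z)"
        using singularity open_axial[OF T_open] unfolding removable_singularity_def by blast
      thus ?thesis ..
    next
      case True
      have not_rem: "\<not> removable_singularity A f I (emb I z)"
      proof
        assume rem: "removable_singularity A f I (emb I z)"
        have "\<exists>c. G \<midarrow>z\<rightarrow> c"
        proof (rule removable_imp_limit[OF I _ R(1) rem])
          show "emb I w \<in> A \<and> G w = proj I (f (emb I w))" if "w \<in> ball z R - {z}" for w
          proof -
            have w: "w \<in> S"
              using that R(2) by blast
            thus ?thesis
              using A_iff[OF I, of w] f_G[OF I w] I by simp
          qed
        qed
        thus False
          using True not_tendsto_and_filterlim_at_infinity[OF at_neq_bot] unfolding is_pole_def by blast
      qed
      obtain r a l where ral: "0 < r" "r \<le> R" "Defs.laurent_expansion f I (emb I z) r a"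
        "l \<ge> 0" "\<And>n. n > l \<Longrightarrow> a (- n) = 0"
      proof (rule pole_imp_laurent_expansion[OF I R(1) _ True])
        show "G holomorphic_on ball z R - {z}"
          using G_hol R(2) by (rule holomorphic_on_subset)
        show "f (emb I w) = emb I (G w)" if "w \<in> ball z R - {z}" for w
          using that R(2) f_G[OF I] by blast
      qed blast
      have "pole_at A f I (emb I z)"
        unfolding pole_at_def using singularity not_rem ral disc[OF ral(2)] by blast
      thus ?thesis ..
    qed
  qed
  show ?thesis
  proof
    show "semiregular_with UNIV A f"
      unfolding semiregular_with_def
    proof (intro conjI ballI)
      show "symmetric_slice_domain A"
        by fact
      show "regular_on A f"
        using S_open open_axial[OF S_open] G_hol A_iff f_G unfolding A_def
        by (intro regular_onI_holomorphic[where F = G and S = S]) simp_all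
      show "slice_preserving_on A f"
        using A_iff f_G by (auto simp: slice_preserving_on_def slice_eq_range_emb)
      fix p assume p: "p \<in> UNIV - A"
      have q: "emb (slice_unit p) (slice_coord p) = p"
        by (rule emb_slice_unit_coord)
      hence "slice_coord p \<notin> S"
        using p A_iff[of "slice_unit p" "slice_coord p"] by simp
      hence "pole_at A f (slice_unit p) p \<or> removable_singularity A f (slice_unit p) p"
        using sing[of "slice_unit p" "slice_coord p"] q by simp
      thus "\<exists>I\<in>imag_units. pole_at A f I p \<or> removable_singularity A f I p"
        by (rule bexI) simp
    qed simp
    show "f (emb I z) = emb I (remove_sings F z)" if "I \<in> imag_units" "emb I z \<in> A" for I z
      using that A_iff f_G unfolding G_def by blast
  qed
qed

section \<open>The algebra of slice preserving semiregular functions\<close>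

lemma represents_unique:
  assumes "represents f F" "represents f G"
  shows "\<forall>\<^sub>\<approx>z. F z = G z"
proof -
  have "\<forall>\<^sub>\<approx>z. \<forall>I\<in>imag_units. f (emb I z) = emb I (F z)" "\<forall>\<^sub>\<approx>z. \<forall>I\<in>imag_units. f (emb I z) = emb I (G z)"
    using assms by (auto simp: represents_def)
  thus ?thesis
  proof eventually_elim
    case (elim z)
    thus ?case
      using imag_units_nonempty by (metis emb_inj)
  qed
qed

lemma represents_cong:
  assumes "represents f F" "sym_meromorphic G" "\<forall>\<^sub>\<approx>z. F z = G z"
  shows "represents f G"
proof -
  have "\<forall>\<^sub>\<approx>z. \<forall>I\<in>imag_units. f (emb I z) = emb I (F z)"
    using assms by (auto simp: represents_def)
  hence "\<forall>\<^sub>\<approx>z. \<forall>I\<in>imag_units. f (emb I z) = emb I (G z)"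
    using assms(3) by eventually_elim auto
  thus ?thesis
    using assms(2) by (simp add: represents_def)
qed

lemma semiregular_with_imp_represents:
  assumes "semiregular_with UNIV A f"
  obtains F S where "represents f F" "\<forall>\<^sub>\<approx>z. z \<in> S"
    "\<And>I z. I \<in> imag_units \<Longrightarrow> z \<in> S \<Longrightarrow> emb I z \<in> A"
proof -
  obtain F S where F: "sym_meromorphic F" "\<forall>\<^sub>\<approx>z. z \<in> S"
    "\<And>I z. I \<in> imag_units \<Longrightarrow> emb I z \<in> A \<longleftrightarrow> z \<in> S"
    "\<And>I z. I \<in> imag_units \<Longrightarrow> z \<in> S \<Longrightarrow> f (emb I z) = emb I (F z)"
    using semiregular_imp_meromorphic[OF assms] by metis
  have "\<forall>\<^sub>\<approx>z. \<forall>I\<in>imag_units. f (emb I z) = emb I (F z)"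
    using F(2) by eventually_elim (use F(4) in auto)
  thus ?thesis
    using that F by (auto simp: represents_def)
qed

lemma semiregular_iff_represents: "semiregular UNIV f \<longleftrightarrow> (\<exists>F. represents f F)"
  unfolding semiregular_def
  using semiregular_with_imp_represents meromorphic_imp_semiregular by metis

text \<open>
  Two functions are identified exactly if they come from the same meromorphic function. In particular the
    relation is transitive, which its definition does not show: there the functions are only compared
    where both are regular.
\<close>

lemma semiregular_rel_iff:
  "(f, g) \<in> semiregular_rel UNIV \<longleftrightarrow> (\<exists>F. represents f F \<and> represents g F)"
proof
  assume "(f, g) \<in> semiregular_rel UNIV"
  then obtain A B where A: "semiregular_with UNIV A f" and B: "semiregular_with UNIV B g"
    and AB: "\<forall>q\<in>A \<inter> B. f q = g q"
    by (auto simp: semiregular_rel_def)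
  obtain F S where F: "represents f F" "\<forall>\<^sub>\<approx>z. z \<in> S" "\<And>I z. I \<in> imag_units \<Longrightarrow> z \<in> S \<Longrightarrow> emb I z \<in> A"
    using semiregular_with_imp_represents[OF A] by metis
  obtain G T where G: "represents g G" "\<forall>\<^sub>\<approx>z. z \<in> T" "\<And>I z. I \<in> imag_units \<Longrightarrow> z \<in> T \<Longrightarrow> emb I z \<in> B"
    using semiregular_with_imp_represents[OF B] by metis
  have "\<forall>\<^sub>\<approx>z. \<forall>I\<in>imag_units. g (emb I z) = emb I (G z)"
    using G by (simp add: represents_def)
  hence "\<forall>\<^sub>\<approx>z. \<forall>I\<in>imag_units. f (emb I z) = emb I (G z)"
    using F(2) G(2) by eventually_elim (use F(3) G(3) AB in auto)
  hence "represents f G"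
    using G(1) by (simp add: represents_def)
  thus "\<exists>F. represents f F \<and> represents g F"
    using G(1) by blast
next
  assume "\<exists>F. represents f F \<and> represents g F"
  then obtain F where F: "represents f F" "represents g F"
    by blast
  obtain A where A: "semiregular_with UNIV A f"
    "\<And>I z. I \<in> imag_units \<Longrightarrow> emb I z \<in> A \<Longrightarrow> f (emb I z) = emb I (remove_sings F z)"
    using meromorphic_imp_semiregular[OF F(1)] by metis
  obtain B where B: "semiregular_with UNIV B g"
    "\<And>I z. I \<in> imag_units \<Longrightarrow> emb I z \<in> B \<Longrightarrow> g (emb I z) = emb I (remove_sings F z)"
    using meromorphic_imp_semiregular[OF F(2)] by metis
  have "f q = g q" if "q \<in> A" "q \<in> B" for q
    using that A(2)[of "slice_unit q" "slice_coord q"] B(2)[of "slice_unit q" "slice_coord q"]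
    by (simp add: emb_slice_unit_coord)
  thus "(f, g) \<in> semiregular_rel UNIV"
    using A(1) B(1) by (auto simp: semiregular_rel_def)
qed

definition represented_class :: "(complex \<Rightarrow> complex) \<Rightarrow> (quat \<Rightarrow> quat) set" where
  "represented_class F = {f. represents f F}"

lemma semiregular_class_eq:
  assumes "represents f F"
  shows "semiregular_class UNIV f = represented_class F"
proof -
  have "represents g F" if "represents f G" "represents g G" for g G
    using represents_cong[OF that(2)] represents_unique[OF that(1) assms] assms by (auto simp: represents_def)
  thus ?thesis
    using assms by (auto simp: semiregular_class_def semiregular_rel_iff represented_class_def)
qed

lemma represents_slice_lift:
  assumes "sym_meromorphic F"
  shows "represents (slice_lift F) F"
  using assms by (auto simp: represents_def sym_meromorphic_def slice_lift_emb)

lemma represented_class_eq_iff: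
  assumes "sym_meromorphic F" "sym_meromorphic G"
  shows "represented_class F = represented_class G \<longleftrightarrow> (\<forall>\<^sub>\<approx>z. F z = G z)"
proof
  assume "represented_class F = represented_class G"
  hence "represents (slice_lift F) G"
    using represents_slice_lift[OF assms(1)] by (auto simp: represented_class_def)
  thus "\<forall>\<^sub>\<approx>z. F z = G z"
    using represents_slice_lift[OF assms(1)] represents_unique by blast
next
  assume eq: "\<forall>\<^sub>\<approx>z. F z = G z"
  moreover from eq have "\<forall>\<^sub>\<approx>z. G z = F z"
    by (simp add: eq_commute)
  ultimately show "represented_class F = represented_class G"
    using represents_cong assms unfolding represented_class_def by blast
qed

lemma carrier_Ms: "carrier (Ms UNIV) = represented_class ` {F. sym_meromorphic F}"
proof -
  have "carrier (Ms UNIV) = semiregular_class UNIV ` {f. semiregular UNIV f}"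
    by (auto simp: Ms_def quotient_def semiregular_class_def)
  also have "\<dots> = represented_class ` {F. sym_meromorphic F}"
  proof safe
    fix f assume "semiregular UNIV f"
    then obtain F where F: "represents f F"
      by (auto simp: semiregular_iff_represents)
    moreover have "sym_meromorphic F"
      using F by (simp add: represents_def)
    ultimately show "semiregular_class UNIV f \<in> represented_class ` {F. sym_meromorphic F}"
      using semiregular_class_eq by blast
  next
    fix F assume "sym_meromorphic F"
    hence F: "represents (slice_lift F) F"
      by (rule represents_slice_lift)
    thus "represented_class F \<in> semiregular_class UNIV ` {f. semiregular UNIV f}"
      using semiregular_class_eq[OF F] semiregular_iff_represents by blast
  qed
  finally show ?thesis .
qed

lemma represents_add:
  assumes "represents f F" "represents g G"
  shows "represents (\<lambda>q. f q + g q) (\<lambda>z. F z + G z)"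
proof -
  have "\<forall>\<^sub>\<approx>z. \<forall>I\<in>imag_units. f (emb I z) = emb I (F z)" "\<forall>\<^sub>\<approx>z. \<forall>I\<in>imag_units. g (emb I z) = emb I (G z)"
    using assms by (auto simp: represents_def)
  hence "\<forall>\<^sub>\<approx>z. \<forall>I\<in>imag_units. f (emb I z) + g (emb I z) = emb I (F z + G z)"
    by eventually_elim (auto simp: emb_add)
  thus ?thesis
    using assms by (simp add: represents_def)
qed

lemma represents_mult:
  assumes "represents f F" "represents g G"
  shows "represents (\<lambda>q. f q * g q) (\<lambda>z. F z * G z)"
proof -
  have "\<forall>\<^sub>\<approx>z. \<forall>I\<in>imag_units. f (emb I z) = emb I (F z)" "\<forall>\<^sub>\<approx>z. \<forall>I\<in>imag_units. g (emb I z) = emb I (G z)"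
    using assms by (auto simp: represents_def)
  hence "\<forall>\<^sub>\<approx>z. \<forall>I\<in>imag_units. f (emb I z) * g (emb I z) = emb I (F z * G z)"
    by eventually_elim (auto simp: emb_mult)
  thus ?thesis
    using assms by (simp add: represents_def)
qed

lemma represents_of_real: "represents (\<lambda>_. of_real c) (\<lambda>_. of_real c)"
  by (simp add: represents_def)

lemma UN_represented_class:
  assumes "sym_meromorphic F" "\<And>f. represents f F \<Longrightarrow> X f = Y"
  shows "(\<Union>f\<in>represented_class F. X f) = Y"
  using assms(2) represents_slice_lift[OF assms(1)] by (auto simp: represented_class_def)

lemma add_Ms:
  assumes "sym_meromorphic F" "sym_meromorphic G"
  shows "represented_class F \<oplus>\<^bsub>Ms UNIV\<^esub> represented_class G = represented_class (\<lambda>z. F z + G z)"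
  unfolding Ms_def
  by (simp, intro UN_represented_class assms) (rule semiregular_class_eq[OF represents_add])

lemma mult_Ms:
  assumes "sym_meromorphic F" "sym_meromorphic G"
  shows "represented_class F \<otimes>\<^bsub>Ms UNIV\<^esub> represented_class G = represented_class (\<lambda>z. F z * G z)"
  unfolding Ms_def
  by (simp, intro UN_represented_class assms) (rule semiregular_class_eq[OF represents_mult])

lemma smult_Ms:
  assumes "sym_meromorphic F"
  shows "c \<odot>\<^bsub>Ms UNIV\<^esub> represented_class F = represented_class (\<lambda>z. of_real c * F z)"
proof -
  have "semiregular_class UNIV (\<lambda>q. c *\<^sub>R f q) = represented_class (\<lambda>z. of_real c * F z)" if "represents f F" for f
    using semiregular_class_eq[OF represents_mult[OF represents_of_real[of c] that]]
    by (simp add: scaleR_conv_of_real)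
  thus ?thesis
    unfolding Ms_def by (simp, intro UN_represented_class assms)
qed

lemma one_Ms: "\<one>\<^bsub>Ms UNIV\<^esub> = represented_class (\<lambda>_. 1)"
  using semiregular_class_eq[OF represents_of_real[of 1]] by (simp add: Ms_def)

section \<open>Endomorphisms are compositions with an entire function\<close>

lemma entire_slice_preservingE:
  assumes "entire \<alpha>" "slice_preserving_on UNIV \<alpha>"
  obtains a where "a holomorphic_on UNIV" "conj_symmetric a"
    "\<And>I z. I \<in> imag_units \<Longrightarrow> \<alpha> (emb I z) = emb I (a z)"
  using slice_preserving_regular_holomorphic[OF symmetric_slice_domain_UNIV, of \<alpha> UNIV] assms
  by (auto simp: entire_def)

lemma entire_slice_lift:
  assumes "a holomorphic_on UNIV" "conj_symmetric a"
  shows "entire (slice_lift a)" "slice_preserving_on UNIV (slice_lift a)"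
proof -
  show "entire (slice_lift a)"
    unfolding entire_def using assms slice_lift_emb[OF _ assms(2)]
    by (intro regular_onI_holomorphic[where F = a and S = UNIV]) simp_all
  show "slice_preserving_on UNIV (slice_lift a)"
    using slice_lift_emb[OF _ assms(2)] by (auto simp: slice_preserving_on_def slice_eq_range_emb)
qed

text \<open>
  Values of the quotients at zeros of the denominators do not disturb this: the division by zero gives
    zero on both sides.
\<close>

lemma represents_divide:
  assumes a: "a holomorphic_on UNIV" "conj_symmetric a" and b: "b holomorphic_on UNIV" "conj_symmetric b"
    and \<alpha>: "\<And>I z. I \<in> imag_units \<Longrightarrow> \<alpha> (emb I z) = emb I (a z)"
    and \<beta>: "\<And>I z. I \<in> imag_units \<Longrightarrow> \<beta> (emb I z) = emb I (b z)"
  shows "represents (\<lambda>q. \<alpha> q / \<beta> q) (\<lambda>z. a z / b z)"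
proof -
  have "sym_meromorphic (\<lambda>z. a z * inverse (b z))"
    using a b by (intro sym_meromorphic_mult sym_meromorphic_inverse sym_meromorphic_holomorphic)
  moreover have "\<alpha> (emb I z) / \<beta> (emb I z) = emb I (a z / b z)" if "I \<in> imag_units" for I z
    using that by (simp add: \<alpha> \<beta> emb_divide)
  ultimately show ?thesis
    by (simp add: represents_def divide_inverse)
qed

lemma entire_quotient_slice_lift:
  assumes a: "a holomorphic_on UNIV" "conj_symmetric a" and b: "b holomorphic_on UNIV" "conj_symmetric b"
    and nz: "\<forall>\<^sub>\<approx>z. b z \<noteq> 0" and F: "sym_meromorphic F" "\<forall>\<^sub>\<approx>z. F z = a z / b z"
  shows "entire_quotient (represented_class F) (slice_lift a) (slice_lift b)"
proof -
  obtain z where "b z \<noteq> 0"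
    using eventually_happens[OF eventually_at_if_cosparse[OF nz, of 0]] by auto
  hence "slice_lift b (emb (Quat 0 1 0 0) z) \<noteq> 0"
    using imag_units_nonempty by (simp add: slice_lift_emb b)
  moreover have "represents (\<lambda>q. slice_lift a q / slice_lift b q) (\<lambda>z. a z / b z)"
    using a b by (intro represents_divide) (simp_all add: slice_lift_emb)
  hence "represents (\<lambda>q. slice_lift a q / slice_lift b q) F"
    by (rule represents_cong[OF _ F(1)]) (use F(2) in \<open>simp add: eq_commute\<close>)
  ultimately show ?thesis
    unfolding entire_quotient_def represented_class_def
    using entire_slice_lift[OF a] entire_slice_lift[OF b] by blast
qed

text \<open>
  Equality off a discrete set extends to all points, because both sides are continuous on each slice.
\<close>

lemma entire_eq_slice_lift:
  assumes ent: "entire f" and rep: "represents f F" and hol: "F holomorphic_on UNIV"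
  shows "f = slice_lift F"
proof
  fix q
  define I where "I = slice_unit q"
  define z where "z = slice_coord q"
  have I: "I \<in> imag_units" and q: "q = emb I z"
    by (simp_all add: I_def z_def emb_slice_unit_coord)
  have "isCont (\<lambda>w. f (emb I w)) z"
    using ent I unfolding entire_def by (intro regular_on_isCont[where D = UNIV]) auto
  moreover have "isCont F z"
    using holomorphic_on_imp_continuous_on[OF hol] by (simp add: continuous_on_eq_continuous_at)
  hence "isCont (\<lambda>w. emb I (F w)) z"
    by (rule bounded_linear.isCont[OF bounded_linear_emb])
  moreover have "\<forall>\<^sub>\<approx>w. f (emb I w) = emb I (F w)"
    using rep I by (auto simp: represents_def elim: eventually_mono)
  hence ev: "\<forall>\<^sub>F w in at z. f (emb I w) = emb I (F w)"
    by (rule eventually_at_if_cosparse)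
  ultimately have "(\<lambda>w. emb I (F w)) \<midarrow>z\<rightarrow> f (emb I z)" "(\<lambda>w. emb I (F w)) \<midarrow>z\<rightarrow> emb I (F z)"
    using tendsto_cong[OF ev] by (auto simp: isCont_def)
  hence "f (emb I z) = emb I (F z)"
    using LIM_unique by blast
  thus "f q = slice_lift F q"
    unfolding q[symmetric] by (simp add: slice_lift_def I_def z_def)
qed

text \<open>
  The transport of \<open>\<phi>\<close> to functions on the plane: choose a meromorphic function in the image class and
    remove its removable singularities.
\<close>

definition induced_endo ::
  "((quat \<Rightarrow> quat) set \<Rightarrow> (quat \<Rightarrow> quat) set) \<Rightarrow> (complex \<Rightarrow> complex) \<Rightarrow> complex \<Rightarrow> complex" where
  "induced_endo \<phi> F =
     remove_sings (SOME G. sym_meromorphic G \<and> \<phi> (represented_class F) = represented_class G)"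

lemma induced_endo_represents:
  assumes \<phi>: "algebra_endomorphism (Ms UNIV) \<phi>" and F: "sym_meromorphic F"
  shows "sym_meromorphic (induced_endo \<phi> F)" "induced_endo \<phi> F nicely_meromorphic_on UNIV"
    "\<phi> (represented_class F) = represented_class (induced_endo \<phi> F)"
proof -
  define G where "G = (SOME G. sym_meromorphic G \<and> \<phi> (represented_class F) = represented_class G)"
  have "\<phi> (represented_class F) \<in> carrier (Ms UNIV)"
    by (rule ring_hom_closed) (use \<phi> F in \<open>auto simp: algebra_endomorphism_def carrier_Ms\<close>)
  hence "\<exists>G. sym_meromorphic G \<and> \<phi> (represented_class F) = represented_class G"
    by (auto simp: carrier_Ms)
  from someI_ex[OF this] have G: "sym_meromorphic G" "\<phi> (represented_class F) = represented_class G"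
    by (simp_all add: G_def)
  have eq: "induced_endo \<phi> F = remove_sings G"
    by (simp add: induced_endo_def G_def)
  have G': "G meromorphic_on UNIV" "conj_symmetric G"
    using G(1) by (auto simp: sym_meromorphic_def)
  show "sym_meromorphic (induced_endo \<phi> F)"
    using G' by (simp add: eq sym_meromorphic_def remove_sings_meromorphic conj_symmetric_remove_sings)
  moreover show "induced_endo \<phi> F nicely_meromorphic_on UNIV"
    using G' by (simp add: eq remove_sings_nicely_meromorphic)
  ultimately show "\<phi> (represented_class F) = represented_class (induced_endo \<phi> F)"
    using represented_class_eq_iff[OF G(1), of "remove_sings G"] G(2) eventually_remove_sings_eq[OF G'(1)]
    by (simp add: eq eq_commute)
qed

lemma sym_meromorphic_endo_induced_endo:
  assumes \<phi>: "algebra_endomorphism (Ms UNIV) \<phi>"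
  shows "sym_meromorphic_endo (induced_endo \<phi>)"
proof -
  note ind = induced_endo_represents[OF \<phi>]
  have hom: "\<phi> \<in> ring_hom (Ms UNIV) (Ms UNIV)"
    and smult: "\<And>c F. F \<in> carrier (Ms UNIV) \<Longrightarrow> \<phi> (c \<odot>\<^bsub>Ms UNIV\<^esub> F) = c \<odot>\<^bsub>Ms UNIV\<^esub> \<phi> F"
    using \<phi> by (auto simp: algebra_endomorphism_def)
  have carrier: "represented_class F \<in> carrier (Ms UNIV)" if "sym_meromorphic F" for F
    using that by (auto simp: carrier_Ms)
  show ?thesis
  proof
    fix F G assume F: "sym_meromorphic F" and G: "sym_meromorphic G"
    show "sym_meromorphic (induced_endo \<phi> F)" "induced_endo \<phi> F nicely_meromorphic_on UNIV"
      using ind[OF F] by auto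
    show "induced_endo \<phi> F = induced_endo \<phi> G" if "\<forall>\<^sub>\<approx>z. F z = G z"
      using that F G represented_class_eq_iff[OF F G] by (simp add: induced_endo_def)
    have "represented_class (induced_endo \<phi> (\<lambda>w. F w + G w)) =
            \<phi> (represented_class F \<oplus>\<^bsub>Ms UNIV\<^esub> represented_class G)"
      using ind(3)[OF sym_meromorphic_add[OF F G]] add_Ms[OF F G] by simp
    also have "\<dots> = \<phi> (represented_class F) \<oplus>\<^bsub>Ms UNIV\<^esub> \<phi> (represented_class G)"
      by (rule ring_hom_add[OF hom carrier[OF F] carrier[OF G]])
    also have "\<dots> = represented_class (\<lambda>z. induced_endo \<phi> F z + induced_endo \<phi> G z)"
      unfolding ind(3)[OF F] ind(3)[OF G] by (rule add_Ms[OF ind(1)[OF F] ind(1)[OF G]])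
    finally show "\<forall>\<^sub>\<approx>z. induced_endo \<phi> (\<lambda>w. F w + G w) z = induced_endo \<phi> F z + induced_endo \<phi> G z"
      by (subst (asm) represented_class_eq_iff)
        (intro ind(1) sym_meromorphic_add F G)+
    have "represented_class (induced_endo \<phi> (\<lambda>w. F w * G w)) =
            \<phi> (represented_class F \<otimes>\<^bsub>Ms UNIV\<^esub> represented_class G)"
      using ind(3)[OF sym_meromorphic_mult[OF F G]] mult_Ms[OF F G] by simp
    also have "\<dots> = \<phi> (represented_class F) \<otimes>\<^bsub>Ms UNIV\<^esub> \<phi> (represented_class G)"
      by (rule ring_hom_mult[OF hom carrier[OF F] carrier[OF G]])
    also have "\<dots> = represented_class (\<lambda>z. induced_endo \<phi> F z * induced_endo \<phi> G z)"
      unfolding ind(3)[OF F] ind(3)[OF G] by (rule mult_Ms[OF ind(1)[OF F] ind(1)[OF G]])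
    finally show "\<forall>\<^sub>\<approx>z. induced_endo \<phi> (\<lambda>w. F w * G w) z = induced_endo \<phi> F z * induced_endo \<phi> G z"
      by (subst (asm) represented_class_eq_iff)
        (intro ind(1) sym_meromorphic_mult F G)+
  next
    fix c
    have one: "\<phi> (represented_class (\<lambda>_. 1)) = represented_class (\<lambda>_. 1)"
      using ring_hom_one[OF hom] by (simp add: one_Ms)
    have "\<phi> (represented_class (\<lambda>_. of_real c)) = represented_class (\<lambda>_. of_real c)"
      using smult[OF carrier[OF sym_meromorphic_one], of c] smult_Ms[OF sym_meromorphic_one, of c]
      by (simp add: one)
    hence "represented_class (induced_endo \<phi> (\<lambda>_. of_real c)) = represented_class (\<lambda>_. of_real c)"
      by (simp only: ind(3)[OF sym_meromorphic_const[of c]])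
    thus "\<forall>\<^sub>\<approx>z. induced_endo \<phi> (\<lambda>_. of_real c) z = of_real c"
      by (subst (asm) represented_class_eq_iff) (intro ind(1) sym_meromorphic_const)+
  qed
qed

theorem theorem6p8:
  fixes \<phi> :: "(quat \<Rightarrow> quat) set \<Rightarrow> (quat \<Rightarrow> quat) set"
  assumes "algebra_endomorphism (Ms UNIV) \<phi>"
  shows "\<exists>!h. entire h \<and> (\<forall>F \<in> carrier (Ms UNIV). is_composition (\<phi> F) F h)"
proof -
  define \<psi> where "\<psi> = induced_endo \<phi>"
  note ind = induced_endo_represents[OF assms, folded \<psi>_def]
  interpret sym_meromorphic_endo \<psi>
    unfolding \<psi>_def by (rule sym_meromorphic_endo_induced_endo[OF assms])
  define h where "h = \<psi> (\<lambda>z. z)"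
  have h: "h holomorphic_on UNIV" "conj_symmetric h"
    unfolding h_def by (rule entire; simp add: conj_symmetric_def)+
  have h_emb: "slice_lift h (emb I z) = emb I (h z)" if "I \<in> imag_units" for I z
    by (rule slice_lift_emb[OF that h(2)])
  show ?thesis
  proof (rule ex1I)
    show "entire (slice_lift h) \<and> (\<forall>F\<in>carrier (Ms UNIV). is_composition (\<phi> F) F (slice_lift h))"
    proof (intro conjI ballI)
      show "entire (slice_lift h)"
        by (rule entire_slice_lift[OF h])
      fix C assume "C \<in> carrier (Ms UNIV)"
      then obtain F where F: "sym_meromorphic F" and C: "C = represented_class F"
        by (auto simp: carrier_Ms)
      show "is_composition (\<phi> C) C (slice_lift h)"
        unfolding is_composition_def
      proof (intro conjI allI impI)
        obtain a b where "a holomorphic_on UNIV" "conj_symmetric a" "b holomorphic_on UNIV" "conj_symmetric b"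
          "\<forall>\<^sub>\<approx>z. b z \<noteq> 0" "\<forall>\<^sub>\<approx>z. F z = a z / b z"
          using sym_meromorphic_entire_quotient[OF F] by metis
        from entire_quotient_slice_lift[OF this(1-5) F this(6)]
        show "\<exists>\<alpha> \<beta>. entire_quotient C \<alpha> \<beta>"
          unfolding C by blast
      next
        fix \<alpha> \<beta> assume "entire_quotient C \<alpha> \<beta>"
        hence \<alpha>: "entire \<alpha>" "slice_preserving_on UNIV \<alpha>" and \<beta>: "entire \<beta>" "slice_preserving_on UNIV \<beta>"
          and \<beta>_nz: "\<exists>q. \<beta> q \<noteq> 0" and rep: "represents (\<lambda>q. \<alpha> q / \<beta> q) F"
          by (auto simp: entire_quotient_def C represented_class_def)
        obtain a where a: "a holomorphic_on UNIV" "conj_symmetric a"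
          "\<And>I z. I \<in> imag_units \<Longrightarrow> \<alpha> (emb I z) = emb I (a z)"
          using entire_slice_preservingE[OF \<alpha>] by metis
        obtain b where b: "b holomorphic_on UNIV" "conj_symmetric b"
          "\<And>I z. I \<in> imag_units \<Longrightarrow> \<beta> (emb I z) = emb I (b z)"
          using entire_slice_preservingE[OF \<beta>] by metis
        note sma = sym_meromorphic_holomorphic[OF a(1,2)] and smb = sym_meromorphic_holomorphic[OF b(1,2)]
        obtain q where "\<beta> q \<noteq> 0"
          using \<beta>_nz by blast
        hence "b (slice_coord q) \<noteq> 0"
          using b(3)[of "slice_unit q" "slice_coord q"] by (auto simp: emb_slice_unit_coord)
        hence b_nz: "\<forall>\<^sub>\<approx>z. b z \<noteq> 0"
          by (rule holomorphic_nonzero_cosparse[OF b(1)])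
        have "\<forall>\<^sub>\<approx>z. F z = a z / b z"
          by (rule represents_unique[OF rep represents_divide[OF a(1,2) b(1,2) a(3) b(3)]])
        hence "\<forall>\<^sub>\<approx>z. a z = F z * b z"
          using b_nz by eventually_elim simp
        hence \<psi>_eq: "\<psi> a = \<psi> (\<lambda>z. F z * b z)"
          using sma smb F by (intro cong) auto
        have \<psi>_a: "\<psi> a z = a (h z)" and \<psi>_b: "\<psi> b z = b (h z)" for z
          unfolding h_def by (rule entire_eq_compose[OF a(1,2)], rule entire_eq_compose[OF b(1,2)])
        have mult_eq: "\<forall>\<^sub>\<approx>z. a (h z) = \<psi> F z * b (h z)"
          using mult[OF F smb] by (simp only: \<psi>_eq[symmetric] \<psi>_a \<psi>_b)
        have bh_nz: "\<forall>\<^sub>\<approx>z. b (h z) \<noteq> 0"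
          using nonzero[OF smb b_nz] by (simp only: \<psi>_b simp_thms)
        obtain z where "b (h z) \<noteq> 0"
          using eventually_happens[OF eventually_at_if_cosparse[OF bh_nz, of 0]] by auto
        thus "\<exists>q. \<beta> (slice_lift h q) \<noteq> 0"
          using imag_units_nonempty by (intro exI[of _ "emb (Quat 0 1 0 0) z"]) (simp add: h_emb b(3))
        have "\<forall>\<^sub>\<approx>z. \<forall>I\<in>imag_units. \<alpha> (slice_lift h (emb I z)) / \<beta> (slice_lift h (emb I z)) = emb I (\<psi> F z)"
          using mult_eq bh_nz by eventually_elim (simp add: h_emb a(3) b(3) flip: emb_divide)
        hence "represents (\<lambda>q. \<alpha> (slice_lift h q) / \<beta> (slice_lift h q)) (\<psi> F)"
          using ind(1)[OF F] by (simp add: represents_def)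
        thus "(\<lambda>q. \<alpha> (slice_lift h q) / \<beta> (slice_lift h q)) \<in> \<phi> C"
          unfolding C ind(3)[OF F] by (simp add: represented_class_def)
      qed
    qed
  next
    fix k assume k: "entire k \<and> (\<forall>F\<in>carrier (Ms UNIV). is_composition (\<phi> F) F k)"
    have "entire_quotient (represented_class (\<lambda>z. z)) (slice_lift (\<lambda>z. z)) (slice_lift (\<lambda>_. 1))"
      by (rule entire_quotient_slice_lift) (auto simp: conj_symmetric_def)
    moreover have "slice_lift (\<lambda>z. z) = (\<lambda>q. q)" "slice_lift (\<lambda>_. 1) = (\<lambda>_. 1)"
      by (simp_all add: slice_lift_def fun_eq_iff emb_slice_unit_coord)
    ultimately have "entire_quotient (represented_class (\<lambda>z. z)) (\<lambda>q. q) (\<lambda>_. 1)"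
      by simp
    moreover have "represented_class (\<lambda>z. z) \<in> carrier (Ms UNIV)"
      by (auto simp: carrier_Ms)
    ultimately have "(\<lambda>q. k q / 1) \<in> \<phi> (represented_class (\<lambda>z. z))"
      using k unfolding is_composition_def by blast
    hence "represents k h"
      unfolding ind(3)[OF sym_meromorphic_ident] h_def by (simp add: represented_class_def)
    thus "k = slice_lift h"
      using k h(1) entire_eq_slice_lift by blast
  qed
qed

end
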